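(* Let $G$ be a directed graph with positive edge weights $w\colon E(G)\to\mathbb{R}_{+}$, let $s,t\in V(G)$, and let $P$ be a shortest path from $s$ to $t$ in $(G,w)$. Then a minimum-cardinality anti-forcing set for $P$ can be computed in polynomial time.
   Context: A set $S\subseteq E(G)$ is an anti-forcing set for the shortest $s$-$t$ path $P$ if $S\cap E(P)=\varnothing$ and every shortest $s$-$t$ path $P'\neq P$ in $(G,w)$ satisfies $S\cap E(P')\neq\varnothing$. *)

theory Defs
  imports "Graph_Theory.Shortest_Path" "HOL-Computational_Algebra.Polynomial"
begin

context wf_digraph
begin

definition shortest_path :: "('b \<Rightarrow> real) \<Rightarrow> 'a \<Rightarrow> 'b list \<Rightarrow> 'a \<Rightarrow> bool" where
  "shortest_path w s P t \<longleftrightarrow>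
     apath s P t \<and> (\<forall>P'. apath s P' t \<longrightarrow> awalk_cost w P \<le> awalk_cost w P')"

definition anti_forcing_set :: "('b \<Rightarrow> real) \<Rightarrow> 'a \<Rightarrow> 'a \<Rightarrow> 'b list \<Rightarrow> 'b set \<Rightarrow> bool" where
  "anti_forcing_set w s t P S \<longleftrightarrow>
     S \<subseteq> arcs G \<and> S \<inter> set P = {} \<and>
     (\<forall>P'. shortest_path w s P' t \<and> P' \<noteq> P \<longrightarrow> S \<inter> set P' \<noteq> {})"

definition minimum_anti_forcing_set ::
    "('b \<Rightarrow> real) \<Rightarrow> 'a \<Rightarrow> 'a \<Rightarrow> 'b list \<Rightarrow> 'b set \<Rightarrow> bool" where
  "minimum_anti_forcing_set w s t P S \<longleftrightarrow>
     anti_forcing_set w s t P S \<and> (\<forall>S'. anti_forcing_set w s t P S' \<longrightarrow> card S \<le> card S')"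

end

text \<open>
  The model of computation is a random access machine in the addition-comparison model over the
  reals, programmed in a while language. The memory consists of arrays of natural numbers and
  arrays of real numbers, with indirect addressing; a scalar is cell 0 of an array.
  There is no multiplication, no real constant, and no conversion between the two sorts, so a
  single step lengthens the binary representation of the largest number occurring by at most a
  constant depending on the program. Hence a polynomial bound on the number of steps excludes the
  usual unit-cost artefacts, and for rational weights, brought
  to a common denominator, it yields polynomial bit complexity.
\<close>

type_synonym name = string

record state =
  nmem :: "name \<Rightarrow> nat \<Rightarrow> nat"
  rmem :: "name \<Rightarrow> nat \<Rightarrow> real"

datatype nexp =
    NConst nat
  | NGet name nexp
  | NAdd nexp nexp
  | NSub nexp nexp

datatype rexp =
    RGet name nexp
  | RAdd rexp rexp
  | RSub rexp rexp

datatype bexp =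
    NLess nexp nexp
  | RLess rexp rexp
  | BNot bexp
  | BAnd bexp bexp

datatype com =
    Skip
  | NSet name nexp nexp
  | RSet name nexp rexp
  | Seq com com
  | Cond bexp com com
  | While bexp com

primrec nval :: "state \<Rightarrow> nexp \<Rightarrow> nat" where
  "nval \<sigma> (NConst k) = k"
| "nval \<sigma> (NGet x i) = nmem \<sigma> x (nval \<sigma> i)"
| "nval \<sigma> (NAdd a b) = nval \<sigma> a + nval \<sigma> b"
| "nval \<sigma> (NSub a b) = nval \<sigma> a - nval \<sigma> b"

primrec rval :: "state \<Rightarrow> rexp \<Rightarrow> real" where
  "rval \<sigma> (RGet x i) = rmem \<sigma> x (nval \<sigma> i)"
| "rval \<sigma> (RAdd a b) = rval \<sigma> a + rval \<sigma> b"
| "rval \<sigma> (RSub a b) = rval \<sigma> a - rval \<sigma> b"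

primrec bval :: "state \<Rightarrow> bexp \<Rightarrow> bool" where
  "bval \<sigma> (NLess a b) \<longleftrightarrow> nval \<sigma> a < nval \<sigma> b"
| "bval \<sigma> (RLess a b) \<longleftrightarrow> rval \<sigma> a < rval \<sigma> b"
| "bval \<sigma> (BNot b) \<longleftrightarrow> \<not> bval \<sigma> b"
| "bval \<sigma> (BAnd a b) \<longleftrightarrow> bval \<sigma> a \<and> bval \<sigma> b"

definition nset :: "name \<Rightarrow> nat \<Rightarrow> nat \<Rightarrow> state \<Rightarrow> state" where
  "nset x i v \<sigma> = \<sigma>\<lparr>nmem := (nmem \<sigma>)(x := (nmem \<sigma> x)(i := v))\<rparr>"

definition rset :: "name \<Rightarrow> nat \<Rightarrow> real \<Rightarrow> state \<Rightarrow> state" where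
  "rset x i v \<sigma> = \<sigma>\<lparr>rmem := (rmem \<sigma>)(x := (rmem \<sigma> x)(i := v))\<rparr>"

text \<open>
  \<open>exec c \<sigma> k \<sigma>'\<close>: started in \<open>\<sigma>\<close>, the program \<open>c\<close> halts in \<open>\<sigma>'\<close> after \<open>k\<close> steps.
  Assignments and tests cost one step: the expressions occurring in a program have constant size.
\<close>

inductive exec :: "com \<Rightarrow> state \<Rightarrow> nat \<Rightarrow> state \<Rightarrow> bool" where
  Skip: "exec Skip \<sigma> 1 \<sigma>"
| NSet: "exec (NSet x i a) \<sigma> 1 (nset x (nval \<sigma> i) (nval \<sigma> a) \<sigma>)"
| RSet: "exec (RSet x i a) \<sigma> 1 (rset x (nval \<sigma> i) (rval \<sigma> a) \<sigma>)"
| Seq: "exec c1 \<sigma> k1 \<sigma>1 \<Longrightarrow> exec c2 \<sigma>1 k2 \<sigma>2 \<Longrightarrow> exec (Seq c1 c2) \<sigma> (k1 + k2) \<sigma>2"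
| CondTrue: "bval \<sigma> b \<Longrightarrow> exec c1 \<sigma> k \<sigma>' \<Longrightarrow> exec (Cond b c1 c2) \<sigma> (1 + k) \<sigma>'"
| CondFalse: "\<not> bval \<sigma> b \<Longrightarrow> exec c2 \<sigma> k \<sigma>' \<Longrightarrow> exec (Cond b c1 c2) \<sigma> (1 + k) \<sigma>'"
| WhileFalse: "\<not> bval \<sigma> b \<Longrightarrow> exec (While b c) \<sigma> 1 \<sigma>"
| WhileTrue: "bval \<sigma> b \<Longrightarrow> exec c \<sigma> k1 \<sigma>1 \<Longrightarrow> exec (While b c) \<sigma>1 k2 \<sigma>2 \<Longrightarrow>
    exec (While b c) \<sigma> (1 + k1 + k2) \<sigma>2"

lemma exec_deterministic:
  "exec c \<sigma> k \<sigma>1 \<Longrightarrow> exec c \<sigma> l \<sigma>2 \<Longrightarrow> l = k \<and> \<sigma>2 = \<sigma>1"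
proof (induction arbitrary: l \<sigma>2 rule: exec.induct)
  case (Seq c1 \<sigma> k1 \<sigma>1 c2 k2 \<sigma>')
  from Seq.prems obtain l1 l2 \<tau>
    where "exec c1 \<sigma> l1 \<tau>" and 2: "exec c2 \<tau> l2 \<sigma>2" and l: "l = l1 + l2"
    by (cases rule: exec.cases) auto
  from Seq.IH(1)[OF this(1)] have "l1 = k1" "\<tau> = \<sigma>1" by auto
  with Seq.IH(2) 2 l show ?case by simp
next
  case (WhileTrue \<sigma> b c k1 \<sigma>1 k2 \<sigma>')
  from WhileTrue.prems WhileTrue.hyps obtain l1 l2 \<tau>
    where "exec c \<sigma> l1 \<tau>" and 2: "exec (While b c) \<tau> l2 \<sigma>2" and l: "l = 1 + l1 + l2"
    by (cases rule: exec.cases) auto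
  from WhileTrue.IH(1)[OF this(1)] have "l1 = k1" "\<tau> = \<sigma>1" by auto
  with WhileTrue.IH(2) 2 l show ?case by simp
next
  case (CondTrue \<sigma> b c1 k \<sigma>' c2)
  from CondTrue.prems CondTrue.hyps obtain l1 where "exec c1 \<sigma> l1 \<sigma>2" "l = 1 + l1"
    by (cases rule: exec.cases) auto
  with CondTrue.IH show ?case by simp
next
  case (CondFalse \<sigma> b c2 k \<sigma>' c1)
  from CondFalse.prems CondFalse.hyps obtain l1 where "exec c2 \<sigma> l1 \<sigma>2" "l = 1 + l1"
    by (cases rule: exec.cases) auto
  with CondFalse.IH show ?case by simp
next
  case Skip
  from Skip.prems show ?case by (cases rule: exec.cases) auto
next
  case NSet
  from NSet.prems show ?case by (cases rule: exec.cases) auto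
next
  case RSet
  from RSet.prems show ?case by (cases rule: exec.cases) auto
next
  case WhileFalse
  from WhileFalse.prems WhileFalse.hyps show ?case by (cases rule: exec.cases) auto
qed

text \<open>
  An instance is presented as a list of weighted arcs: vertices and arcs are identified by their
  numbers under \<open>vn\<close> and \<open>en\<close>, and \<open>P\<close> is given by its sequence of arc numbers.
  The contents of all cells not mentioned are arbitrary.
\<close>

definition numbering :: "('x \<Rightarrow> nat) \<Rightarrow> 'x set \<Rightarrow> bool" where
  "numbering f A \<longleftrightarrow> bij_betw f A {..<card A}"

definition encodes_input ::
    "('v, 'e) pre_digraph \<Rightarrow> ('e \<Rightarrow> real) \<Rightarrow> 'v \<Rightarrow> 'v \<Rightarrow> 'e list \<Rightarrow>
     ('v \<Rightarrow> nat) \<Rightarrow> ('e \<Rightarrow> nat) \<Rightarrow> state \<Rightarrow> bool" where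
  "encodes_input G w s t P vn en \<sigma> \<longleftrightarrow>
     nmem \<sigma> ''n'' 0 = card (verts G) \<and>
     nmem \<sigma> ''m'' 0 = card (arcs G) \<and>
     nmem \<sigma> ''s'' 0 = vn s \<and>
     nmem \<sigma> ''t'' 0 = vn t \<and>
     nmem \<sigma> ''len'' 0 = length P \<and>
     (\<forall>i<length P. nmem \<sigma> ''path'' i = en (P ! i)) \<and>
     (\<forall>e\<in>arcs G. nmem \<sigma> ''tail'' (en e) = vn (tail G e) \<and>
                 nmem \<sigma> ''head'' (en e) = vn (head G e) \<and>
                 rmem \<sigma> ''weight'' (en e) = w e)"

text \<open>The output set is represented by its characteristic vector.\<close>

definition output_set :: "('v, 'e) pre_digraph \<Rightarrow> ('e \<Rightarrow> nat) \<Rightarrow> state \<Rightarrow> 'e set" where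
  "output_set G en \<sigma> = {e \<in> arcs G. nmem \<sigma> ''out'' (en e) \<noteq> 0}"

end

theory Submission
  imports Defs
begin

text \<open>
  Let \<open>d\<close> be a feasible potential, that is \<open>d v \<le> d u + w e\<close> for every arc \<open>e\<close> from \<open>u\<close> to \<open>v\<close>,
  with \<open>d t - d s\<close> equal to the length of \<open>P\<close>. By complementary slackness the shortest paths from \<open>s\<close>
  to \<open>t\<close> are exactly the walks from \<open>s\<close> to \<open>t\<close> along tight arcs. Such a walk differs from \<open>P\<close> if and
  only if it contains a detour: a walk along tight arcs outside \<open>P\<close> that leaves a vertex of \<open>P\<close> and
  returns to a vertex of \<open>P\<close>. Conversely, every detour extends along \<open>P\<close> to a shortest path, because
  tight walks never repeat a vertex. So the anti-forcing sets are the sets of arcs outside \<open>P\<close> that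
  hit all detours. Splitting the vertices of \<open>P\<close> into a single source with their outgoing and a
  single sink with their incoming arcs turns a minimum anti-forcing set into a minimum cut with unit
  capacities, found by augmenting paths. The potential comes from Dijkstra's algorithm with all
  labels capped at the length of \<open>P\<close>.
\<close>

section \<open>Time bounds for programs\<close>

text \<open>The cap on the labels avoids an infinite value for unreachable vertices: since weights
  are positive, the minimum of a feasible potential and a constant is again feasible. The labels
  need not be identified as distances. It is enough that they end up feasible, at most zero at
  \<open>s\<close>, and above one fixed potential \<open>\<pi>\<close> whose values at
  \<open>s\<close> and \<open>t\<close> are known; feasibility along \<open>P\<close> supplies the
  remaining inequality. Potentials increase strictly along tight arcs, so a detour can only return
  at a later vertex of \<open>P\<close>. The order of the vertices on \<open>P\<close> therefore
  never has to be recorded, which is what makes it sound to merge all of them into one source and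
  one sink. Programs are specified by total-correctness triples with a time bound; by determinism
  the run that a triple asserts is the only one. Memory outside the input is arbitrary, so every
  working array is initialised or read only where it has been written.\<close>

definition runs :: "com \<Rightarrow> state \<Rightarrow> nat \<Rightarrow> (state \<Rightarrow> bool) \<Rightarrow> bool" where
  "runs c \<sigma> k Q \<longleftrightarrow> (\<exists>j \<sigma>'. exec c \<sigma> j \<sigma>' \<and> j \<le> k \<and> Q \<sigma>')"

primrec writes :: "com \<Rightarrow> name set" where
  "writes Skip = {}"
| "writes (NSet x i a) = {x}"
| "writes (RSet x i a) = {x}"
| "writes (Seq c1 c2) = writes c1 \<union> writes c2"
| "writes (Cond b c1 c2) = writes c1 \<union> writes c2"
| "writes (While b c) = writes c"

text \<open>The frame condition of a program. One name denotes an array of each sort, so a single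
  set of names covers both memories.\<close>

definition agree :: "name set \<Rightarrow> state \<Rightarrow> state \<Rightarrow> bool" where
  "agree W \<sigma> \<tau> \<longleftrightarrow> (\<forall>x. x \<notin> W \<longrightarrow> nmem \<tau> x = nmem \<sigma> x \<and> rmem \<tau> x = rmem \<sigma> x)"

lemma nmem_nset [simp]: "nmem (nset x i v \<sigma>) y = (if y = x then (nmem \<sigma> x)(i := v) else nmem \<sigma> y)"
  and rmem_nset [simp]: "rmem (nset x i v \<sigma>) y = rmem \<sigma> y"
  and nmem_rset [simp]: "nmem (rset x i r \<sigma>) y = nmem \<sigma> y"
  and rmem_rset [simp]: "rmem (rset x i r \<sigma>) y = (if y = x then (rmem \<sigma> x)(i := r) else rmem \<sigma> y)"
  by (simp_all add: nset_def rset_def)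

lemma agree_nmem: "agree W \<sigma> \<tau> \<Longrightarrow> x \<notin> W \<Longrightarrow> nmem \<tau> x = nmem \<sigma> x"
  and agree_rmem: "agree W \<sigma> \<tau> \<Longrightarrow> x \<notin> W \<Longrightarrow> rmem \<tau> x = rmem \<sigma> x"
  by (simp_all add: agree_def)

lemma agree_refl: "agree W \<sigma> \<sigma>"
  by (simp add: agree_def)

lemma agree_trans: "agree W \<sigma> \<tau> \<Longrightarrow> agree W \<tau> \<upsilon> \<Longrightarrow> agree W \<sigma> \<upsilon>"
  by (simp add: agree_def)

lemma agree_mono: "agree W \<sigma> \<tau> \<Longrightarrow> W \<subseteq> W' \<Longrightarrow> agree W' \<sigma> \<tau>"
  by (auto simp: agree_def)

lemma agree_nset: "x \<in> W \<Longrightarrow> agree W \<sigma> \<tau> \<Longrightarrow> agree W \<sigma> (nset x i v \<tau>)"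
  by (auto simp: agree_def)

lemma exec_agree: "exec c \<sigma> k \<sigma>' \<Longrightarrow> agree (writes c) \<sigma> \<sigma>'"
  by (induction rule: exec.induct) (auto simp: agree_def)

text \<open>The frame is handed over together with the postcondition, so a specification has to
  mention only what its program computes.\<close>

lemma runs_mono: "runs c \<sigma> k Q \<Longrightarrow> k \<le> k' \<Longrightarrow> (\<And>\<sigma>'. Q \<sigma>' \<Longrightarrow> agree (writes c) \<sigma> \<sigma>' \<Longrightarrow> Q' \<sigma>') \<Longrightarrow> runs c \<sigma> k' Q'"
  unfolding runs_def using exec_agree le_trans by blast

lemma runs_le: "runs c \<sigma> k Q \<Longrightarrow> k \<le> k' \<Longrightarrow> runs c \<sigma> k' Q"
  unfolding runs_def using le_trans by blast

lemma runs_Seq: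
  assumes "runs c1 \<sigma> k1 R" "\<And>\<tau>. R \<tau> \<Longrightarrow> agree (writes c1) \<sigma> \<tau> \<Longrightarrow> runs c2 \<tau> k2 Q"
  shows "runs (Seq c1 c2) \<sigma> (k1 + k2) Q"
proof -
  obtain j1 \<tau> where 1: "exec c1 \<sigma> j1 \<tau>" "j1 \<le> k1" "R \<tau>"
    using assms(1) by (auto simp: runs_def)
  then obtain j2 \<sigma>' where "exec c2 \<tau> j2 \<sigma>'" "j2 \<le> k2" "Q \<sigma>'"
    using assms(2)[OF 1(3) exec_agree[OF 1(1)]] by (auto simp: runs_def)
  with 1 show ?thesis unfolding runs_def by (meson add_mono exec.Seq)
qed

lemma runs_Cond:
  assumes "bval \<sigma> b \<Longrightarrow> runs c1 \<sigma> k Q" "\<not> bval \<sigma> b \<Longrightarrow> runs c2 \<sigma> k Q"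
  shows "runs (Cond b c1 c2) \<sigma> (Suc k) Q"
proof (cases "bval \<sigma> b")
  case True
  then obtain j \<sigma>' where "exec c1 \<sigma> j \<sigma>'" "j \<le> k" "Q \<sigma>'"
    using assms by (auto simp: runs_def)
  then show ?thesis using exec.CondTrue[OF True] unfolding runs_def by fastforce
next
  case False
  then obtain j \<sigma>' where "exec c2 \<sigma> j \<sigma>'" "j \<le> k" "Q \<sigma>'"
    using assms by (auto simp: runs_def)
  then show ?thesis using exec.CondFalse[OF False] unfolding runs_def by fastforce
qed

text \<open>In \<open>I f \<tau>\<close>, the number \<open>f\<close> bounds the number of iterations still to come.\<close>

lemma runs_While:
  assumes "I f \<sigma>"
    and step: "\<And>f \<tau>. I f \<tau> \<Longrightarrow> agree (writes c) \<sigma> \<tau> \<Longrightarrow> bval \<tau> b \<Longrightarrow>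
      runs c \<tau> k (\<lambda>\<tau>'. \<exists>f'<f. I f' \<tau>')"
    and exit: "\<And>f \<tau>. I f \<tau> \<Longrightarrow> agree (writes c) \<sigma> \<tau> \<Longrightarrow> \<not> bval \<tau> b \<Longrightarrow> Q \<tau>"
  shows "runs (While b c) \<sigma> (1 + f * (k + 1)) Q"
proof -
  have "runs (While b c) \<tau> (1 + f * (k + 1)) Q" if "I f \<tau>" "agree (writes c) \<sigma> \<tau>" for f \<tau>
    using that
  proof (induction f arbitrary: \<tau> rule: less_induct)
    case (less f)
    show ?case
    proof (cases "bval \<tau> b")
      case False
      then have "exec (While b c) \<tau> 1 \<tau>" by (rule exec.WhileFalse)
      moreover have "Q \<tau>" using exit less.prems False by blast
      ultimately show ?thesis unfolding runs_def by (meson le_add1)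
    next
      case True
      from step[OF less.prems True] obtain j \<tau>' f'
        where 1: "exec c \<tau> j \<tau>'" "j \<le> k" and f': "f' < f" "I f' \<tau>'"
        by (auto simp: runs_def)
      have "agree (writes c) \<sigma> \<tau>'"
        using less.prems(2) exec_agree[OF 1(1)] by (rule agree_trans)
      from less.IH[OF f' this] obtain i \<tau>''
        where 2: "exec (While b c) \<tau>' i \<tau>''" "i \<le> 1 + f' * (k + 1)" "Q \<tau>''"
        by (auto simp: runs_def)
      \<comment> \<open>The drop in the remaining iterations pays for one test and one run of the
        body.\<close>
      have "Suc f' * (k + 1) \<le> f * (k + 1)" using f' by (intro mult_le_mono) auto
      then have "1 + j + i \<le> 1 + f * (k + 1)" using 1 2 by simp
      with exec.WhileTrue[OF True 1(1) 2(1)] 2(3) show ?thesis unfolding runs_def by blast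
    qed
  qed
  then show ?thesis using assms(1) agree_refl by blast
qed

section \<open>Counting loops\<close>

abbreviation Var :: "name \<Rightarrow> nexp" where
  "Var x \<equiv> NGet x (NConst 0)"

definition For :: "name \<Rightarrow> nexp \<Rightarrow> com \<Rightarrow> com" where
  "For x b c = Seq (NSet x (NConst 0) (NConst 0))
     (While (NLess (Var x) b) (Seq c (NSet x (NConst 0) (NAdd (Var x) (NConst 1)))))"

lemma writes_For [simp]: "writes (For x b c) = insert x (writes c)"
  by (auto simp: For_def)

lemma runs_NSet: "Q (nset x (nval \<sigma> i) (nval \<sigma> a) \<sigma>) \<Longrightarrow> runs (NSet x i a) \<sigma> 1 Q"
  unfolding runs_def using exec.NSet by blast

text \<open>The bound is evaluated again at every test, so it must keep its value in every state
  that the frame allows. The counter is an ordinary memory cell, hence the invariant is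
  re-established after its increment. Each round costs the body, one test and one increment;
  initialisation and the last test give the summand 2.\<close>

lemma runs_For:
  assumes init: "I 0 (nset x 0 0 \<sigma>)"
    and bound: "\<And>\<tau>. agree (insert x (writes c)) \<sigma> \<tau> \<Longrightarrow> nval \<tau> b = N"
    and fresh: "x \<notin> writes c"
    and step: "\<And>j \<tau>. I j \<tau> \<Longrightarrow> agree (insert x (writes c)) \<sigma> \<tau> \<Longrightarrow> nmem \<tau> x 0 = j \<Longrightarrow> j < N \<Longrightarrow>
      runs c \<tau> k (\<lambda>\<tau>'. I (Suc j) (nset x 0 (Suc j) \<tau>'))"
    and exit: "\<And>\<tau>. I N \<tau> \<Longrightarrow> agree (insert x (writes c)) \<sigma> \<tau> \<Longrightarrow> Q \<tau>"
  shows "runs (For x b c) \<sigma> (2 + N * (k + 2)) Q"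
proof -
  let ?c = "Seq c (NSet x (NConst 0) (NAdd (Var x) (NConst 1)))"
  let ?A = "agree (insert x (writes c)) \<sigma>"
  let ?I = "\<lambda>f \<tau>. ?A \<tau> \<and> f \<le> N \<and> nmem \<tau> x 0 = N - f \<and> I (N - f) \<tau>"
  have w: "writes ?c = insert x (writes c)" by auto
  have "runs (While (NLess (Var x) b) ?c) (nset x 0 0 \<sigma>) (1 + N * ((k + 1) + 1)) Q"
  proof (rule runs_While[where I = ?I])
    show "?I N (nset x 0 0 \<sigma>)"
      using init by (simp add: agree_nset agree_refl)
    fix f \<tau> assume I: "?I f \<tau>"
    have N: "nval \<tau> b = N" using I bound by blast
    {
      assume b: "bval \<tau> (NLess (Var x) b)"
      then have lt: "N - f < N" "0 < f" using I N by auto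
      have "runs c \<tau> k (\<lambda>\<tau>'. I (Suc (N - f)) (nset x 0 (Suc (N - f)) \<tau>'))"
        using I lt by (intro step) auto
      then have "runs ?c \<tau> (k + 1) (\<lambda>\<tau>'. ?I (f - 1) \<tau>')"
      proof (rule runs_Seq)
        fix \<upsilon> assume J: "I (Suc (N - f)) (nset x 0 (Suc (N - f)) \<upsilon>)" and a: "agree (writes c) \<tau> \<upsilon>"
        have x: "nmem \<upsilon> x 0 = N - f" using agree_nmem[OF a fresh] I by simp
        have "?A \<upsilon>" using I agree_mono[OF a] agree_trans by blast
        then have "?A (nset x 0 (Suc (N - f)) \<upsilon>)" by (simp add: agree_nset)
        moreover have "Suc (N - f) = N - (f - 1)" using I lt by auto
        ultimately show "runs (NSet x (NConst 0) (NAdd (Var x) (NConst 1))) \<upsilon> 1 (\<lambda>\<tau>'. ?I (f - 1) \<tau>')"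
          using J x I by (intro runs_NSet) auto
      qed
      then show "runs ?c \<tau> (k + 1) (\<lambda>\<tau>'. \<exists>f'<f. ?I f' \<tau>')"
        by (rule runs_mono, simp) (use lt in \<open>intro exI[of _ "f - 1"], simp\<close>)
    }
    {
      assume "\<not> bval \<tau> (NLess (Var x) b)"
      then have "f = 0" using I N by auto
      then show "Q \<tau>" using I exit by simp
    }
  qed
  then have "runs (For x b c) \<sigma> (1 + (1 + N * ((k + 1) + 1))) Q"
    unfolding For_def by (intro runs_Seq[where R = "\<lambda>\<tau>. \<tau> = nset x 0 0 \<sigma>"] runs_NSet) auto
  then show ?thesis by (simp add: algebra_simps)
qed

lemma runs_clear:
  assumes "\<And>\<tau>. agree {x, i} \<sigma> \<tau> \<Longrightarrow> nval \<tau> b = N" "i \<noteq> x"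
  shows "runs (For i b (NSet x (Var i) (NConst 0))) \<sigma> (2 + N * (1 + 2)) (\<lambda>\<tau>. \<forall>v<N. nmem \<tau> x v = 0)"
proof (rule runs_For[where I = "\<lambda>j \<tau>. \<forall>v<j. nmem \<tau> x v = 0"])
  fix j and \<tau> :: state assume "\<forall>v<j. nmem \<tau> x v = 0" "nmem \<tau> i 0 = j"
  then show "runs (NSet x (Var i) (NConst 0)) \<tau> 1 (\<lambda>\<tau>'. \<forall>v<Suc j. nmem (nset i 0 (Suc j) \<tau>') x v = 0)"
    using assms(2) by (intro runs_NSet) (simp add: less_Suc_eq)
qed (use assms in \<open>auto simp: insert_commute\<close>)

section \<open>Loop-free code\<close>

primrec loop_free :: "com \<Rightarrow> bool" where
  "loop_free Skip \<longleftrightarrow> True"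
| "loop_free (NSet x i a) \<longleftrightarrow> True"
| "loop_free (RSet x i a) \<longleftrightarrow> True"
| "loop_free (Seq c1 c2) \<longleftrightarrow> loop_free c1 \<and> loop_free c2"
| "loop_free (Cond b c1 c2) \<longleftrightarrow> loop_free c1 \<and> loop_free c2"
| "loop_free (While b c) \<longleftrightarrow> False"

primrec eff :: "com \<Rightarrow> state \<Rightarrow> state" where
  "eff Skip \<sigma> = \<sigma>"
| "eff (NSet x i a) \<sigma> = nset x (nval \<sigma> i) (nval \<sigma> a) \<sigma>"
| "eff (RSet x i a) \<sigma> = rset x (nval \<sigma> i) (rval \<sigma> a) \<sigma>"
| "eff (Seq c1 c2) \<sigma> = eff c2 (eff c1 \<sigma>)"
| "eff (Cond b c1 c2) \<sigma> = (if bval \<sigma> b then eff c1 \<sigma> else eff c2 \<sigma>)"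
| "eff (While b c) \<sigma> = \<sigma>"

text \<open>Adding the costs of both branches, instead of taking the maximum, keeps the bound a
  plain sum.\<close>

primrec steps :: "com \<Rightarrow> nat" where
  "steps Skip = 1"
| "steps (NSet x i a) = 1"
| "steps (RSet x i a) = 1"
| "steps (Seq c1 c2) = steps c1 + steps c2"
| "steps (Cond b c1 c2) = 1 + (steps c1 + steps c2)"
| "steps (While b c) = 1"

text \<open>Verification by evaluation: the simplifier computes the final state through
  \<open>eff\<close>, and no intermediate assertions are required.\<close>

lemma runs_loop_free:
  assumes "loop_free c" "Q (eff c \<sigma>)" "steps c \<le> k"
  shows "runs c \<sigma> k Q"
proof -
  have "\<exists>j\<le>steps c. exec c \<sigma> j (eff c \<sigma>)" using assms(1)
  proof (induction c arbitrary: \<sigma>)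
    case (Seq c1 c2)
    then obtain j1 j2 where "j1 \<le> steps c1" "exec c1 \<sigma> j1 (eff c1 \<sigma>)"
      "j2 \<le> steps c2" "exec c2 (eff c1 \<sigma>) j2 (eff c2 (eff c1 \<sigma>))" by fastforce
    then show ?case using exec.Seq by (metis add_mono eff.simps(4) steps.simps(4))
  next
    case (Cond b c1 c2)
    then obtain j1 j2 where 1: "j1 \<le> steps c1" "exec c1 \<sigma> j1 (eff c1 \<sigma>)"
      "j2 \<le> steps c2" "exec c2 \<sigma> j2 (eff c2 \<sigma>)" by fastforce
    show ?case
    proof (cases "bval \<sigma> b")
      case True
      then have "exec (Cond b c1 c2) \<sigma> (1 + j1) (eff c1 \<sigma>)" using 1 exec.CondTrue by blast
      then show ?thesis using True 1 by (intro exI[of _ "1 + j1"]) auto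
    next
      case False
      then have "exec (Cond b c1 c2) \<sigma> (1 + j2) (eff c2 \<sigma>)" using 1 exec.CondFalse by blast
      then show ?thesis using False 1 by (intro exI[of _ "1 + j2"]) auto
    qed
  next
    case Skip
    show ?case using exec.Skip by auto
  next
    case (NSet x i a)
    show ?case using exec.NSet by auto
  next
    case (RSet x i a)
    show ?case using exec.RSet by auto
  qed simp
  then show ?thesis using assms(2,3) unfolding runs_def using le_trans by blast
qed

section \<open>Polynomially bounded costs\<close>

definition poly_bounded :: "(nat \<Rightarrow> nat \<Rightarrow> nat) \<Rightarrow> bool" where
  "poly_bounded f \<longleftrightarrow> (\<exists>p :: nat poly. \<forall>n m. f n m \<le> poly p (n + m))"

lemma poly_bounded_const: "poly_bounded (\<lambda>n m. c)"
  unfolding poly_bounded_def by (rule exI[of _ "[:c:]"]) simp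

lemma poly_bounded_fst: "poly_bounded (\<lambda>n m. n)"
  and poly_bounded_snd: "poly_bounded (\<lambda>n m. m)"
  unfolding poly_bounded_def by (rule exI[of _ "[:0, 1:]"], simp)+

lemma poly_bounded_add: "poly_bounded f \<Longrightarrow> poly_bounded g \<Longrightarrow> poly_bounded (\<lambda>n m. f n m + g n m)"
  unfolding poly_bounded_def by (metis add_mono poly_add)

lemma poly_bounded_mult: "poly_bounded f \<Longrightarrow> poly_bounded g \<Longrightarrow> poly_bounded (\<lambda>n m. f n m * g n m)"
  unfolding poly_bounded_def by (metis mult_le_mono poly_mult)

lemmas poly_bounded_intros =
  poly_bounded_const poly_bounded_fst poly_bounded_snd poly_bounded_add poly_bounded_mult

section \<open>Minimum cuts with unit capacities\<close>

text \<open>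
  A flow is described by its net value across every cut separating the source from the sink, which
  replaces conservation at the vertices. A cell of \<open>f\<close> counts as one unit of flow if it is nonzero.
\<close>

definition net :: "nat \<Rightarrow> (nat \<Rightarrow> nat) \<Rightarrow> (nat \<Rightarrow> nat) \<Rightarrow> (nat \<Rightarrow> nat) \<Rightarrow> nat set \<Rightarrow> int" where
  "net m src dst f X = (\<Sum>e<m. of_bool (0 < f e) * (of_bool (src e \<in> X) - of_bool (dst e \<in> X)))"

definition residual :: "(nat \<Rightarrow> nat) \<Rightarrow> (nat \<Rightarrow> nat) \<Rightarrow> (nat \<Rightarrow> nat) \<Rightarrow> nat \<Rightarrow> nat \<Rightarrow> nat \<Rightarrow> bool" where
  "residual src dst f e u v \<longleftrightarrow> (f e = 0 \<and> src e = u \<and> dst e = v) \<or> (0 < f e \<and> dst e = u \<and> src e = v)"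

definition cut :: "nat \<Rightarrow> (nat \<Rightarrow> nat) \<Rightarrow> (nat \<Rightarrow> nat) \<Rightarrow> nat set \<Rightarrow> nat set" where
  "cut m src dst X = {e. e < m \<and> src e \<in> X \<and> dst e \<notin> X}"

text \<open>Brings the size of a cut into the form of \<open>net\<close>, so that the two can be
  compared arc by arc.\<close>

lemma card_cut: "int (card (cut m src dst X)) = (\<Sum>e<m. of_bool (src e \<in> X \<and> dst e \<notin> X))"
proof -
  have "cut m src dst X = {..<m} \<inter> {e. src e \<in> X \<and> dst e \<notin> X}" by (auto simp: cut_def)
  then show ?thesis by (simp add: of_bool_def sum.If_cases)
qed

text \<open>Weak duality, termwise: an arc contributes at most one, and something positive only if
  it leaves \<open>X\<close>.\<close>

lemma net_le_cut: "net m src dst f X \<le> int (card (cut m src dst X))"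
  unfolding net_def card_cut by (intro sum_mono) auto

text \<open>The equality case of weak duality: if no residual arc leaves \<open>X\<close>, then
  every arc out of \<open>X\<close> carries flow and no arc into \<open>X\<close> does.\<close>

lemma net_eq_cut:
  assumes "\<And>e u v. e < m \<Longrightarrow> residual src dst f e u v \<Longrightarrow> u \<in> X \<Longrightarrow> v \<in> X"
  shows "net m src dst f X = int (card (cut m src dst X))"
  unfolding net_def card_cut
proof (rule sum.cong)
  fix e assume "e \<in> {..<m}"
  then show "of_bool (0 < f e) * (of_bool (src e \<in> X) - of_bool (dst e \<in> X)) =
      (of_bool (src e \<in> X \<and> dst e \<notin> X) :: int)"
    using assms[of e] by (cases "f e = 0") (auto simp: residual_def)
qed simp

lemma card_cut_le: "card (cut m src dst X) \<le> m"
  using card_mono[of "{..<m}" "cut m src dst X"] by (auto simp: cut_def)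

text \<open>Using an empty arc forwards and cancelling a full one backwards have the same effect on
  every cut. Along a walk these differences telescope, leaving only its two ends.\<close>

lemma net_push:
  assumes "e < m" "residual src dst f e u v"
  shows "net m src dst (f(e := 1 - f e)) X = net m src dst f X + of_bool (u \<in> X) - of_bool (v \<in> X)"
proof -
  have "net m src dst g X = of_bool (0 < g e) * (of_bool (src e \<in> X) - of_bool (dst e \<in> X)) +
      (\<Sum>e\<in>{..<m} - {e}. of_bool (0 < g e) * (of_bool (src e \<in> X) - of_bool (dst e \<in> X)))" for g
    unfolding net_def using assms(1) by (subst sum.remove[of _ e]) auto
  note this[of f] this[of "f(e := 1 - f e)"]
  moreover have "(\<Sum>i\<in>{..<m} - {e}. of_bool (0 < (f(e := 1 - f e)) i) * (of_bool (src i \<in> X) - of_bool (dst i \<in> X))) =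
      (\<Sum>i\<in>{..<m} - {e}. of_bool (0 < f i) * (of_bool (src i \<in> X) - of_bool (dst i \<in> X)) :: int)"
    by (intro sum.cong) auto
  ultimately show ?thesis using assms(2) by (auto simp: residual_def)
qed

lemma residual_push: "residual src dst f d u v \<Longrightarrow> d \<noteq> e \<Longrightarrow> residual src dst (f(e := x)) d u v"
  by (simp add: residual_def)

text \<open>Marks strictly increase along the tree, so they rule out cycles.\<close>

definition search_tree :: "nat \<Rightarrow> nat \<Rightarrow> (nat \<Rightarrow> nat) \<Rightarrow> (nat \<Rightarrow> nat) \<Rightarrow> (nat \<Rightarrow> nat) \<Rightarrow>
    nat \<Rightarrow> (nat \<Rightarrow> nat) \<Rightarrow> (nat \<Rightarrow> nat) \<Rightarrow> bool" where
  "search_tree N m src dst f s mark par \<longleftrightarrow> 0 < mark s \<and>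
     (\<forall>v<N. mark v \<le> card {x. x < N \<and> 0 < mark x}) \<and>
     (\<forall>v<N. 0 < mark v \<longrightarrow> v \<noteq> s \<longrightarrow>
       (\<exists>u<N. par v < m \<and> residual src dst f (par v) u v \<and> 0 < mark u \<and> mark u < mark v))"

text \<open>The new mark exceeds the mark of the parent by one, and the number of marked vertices
  also rises by one, so marks stay below that number. This later bounds the length of an augmenting
  walk; the second claim is the progress measure of the search.\<close>

lemma search_tree_grow:
  assumes "search_tree N m src dst f s mark par" "e < m" "residual src dst f e u v"
    and "u < N" "v < N" "0 < mark u" "mark v = 0"
  shows "search_tree N m src dst f s (mark(v := Suc (mark u))) (par(v := e))"
    and "card {x. x < N \<and> (mark(v := Suc (mark u))) x = 0} < card {x. x < N \<and> mark x = 0}"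
proof -
  have "{x. x < N \<and> (mark(v := Suc (mark u))) x = 0} \<subset> {x. x < N \<and> mark x = 0}"
    using assms by auto
  then show "card {x. x < N \<and> (mark(v := Suc (mark u))) x = 0} < card {x. x < N \<and> mark x = 0}"
    by (intro psubset_card_mono) auto
  have "{x. x < N \<and> 0 < (mark(v := Suc (mark u))) x} = insert v {x. x < N \<and> 0 < mark x}"
    using assms by auto
  then have c: "card {x. x < N \<and> 0 < (mark(v := Suc (mark u))) x} = Suc (card {x. x < N \<and> 0 < mark x})"
    using assms by simp
  show "search_tree N m src dst f s (mark(v := Suc (mark u))) (par(v := e))"
    unfolding search_tree_def c
  proof (intro conjI allI impI)
    show "0 < (mark(v := Suc (mark u))) s" using assms by (simp add: search_tree_def)
  next
    fix x assume "x < N"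
    then have "mark x \<le> card {x. x < N \<and> 0 < mark x}" "mark u \<le> card {x. x < N \<and> 0 < mark x}"
      using assms by (auto simp: search_tree_def)
    then show "(mark(v := Suc (mark u))) x \<le> Suc (card {x. x < N \<and> 0 < mark x})" by simp
  next
    fix x assume x: "x < N" "0 < (mark(v := Suc (mark u))) x" "x \<noteq> s"
    show "\<exists>y<N. (par(v := e)) x < m \<and> residual src dst f ((par(v := e)) x) y x \<and>
        0 < (mark(v := Suc (mark u))) y \<and> (mark(v := Suc (mark u))) y < (mark(v := Suc (mark u))) x"
    proof (cases "x = v")
      case True
      then show ?thesis using assms by (intro exI[of _ u]) auto
    next
      case False
      then obtain y where "y < N" "par x < m" "residual src dst f (par x) y x" "0 < mark y" "mark y < mark x"
        using x assms(1) by (auto simp: search_tree_def)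
      then show ?thesis using False assms by (intro exI[of _ y]) auto
    qed
  qed
qed

text \<open>
  Pushing a unit along the tree from the sink back to the source: when the walk has arrived at \<open>v\<close>,
  the flow has one extra unit across exactly those cuts that separate \<open>v\<close> from the sink.
\<close>

definition partial_augmentation :: "nat \<Rightarrow> nat \<Rightarrow> (nat \<Rightarrow> nat) \<Rightarrow> (nat \<Rightarrow> nat) \<Rightarrow> nat \<Rightarrow> nat \<Rightarrow>
    (nat \<Rightarrow> nat) \<Rightarrow> (nat \<Rightarrow> nat) \<Rightarrow> int \<Rightarrow> (nat \<Rightarrow> nat) \<Rightarrow> nat \<Rightarrow> bool" where
  "partial_augmentation N m src dst s t mark par a f v \<longleftrightarrow> v < N \<and> 0 < mark v \<and>
     (\<forall>X. s \<in> X \<longrightarrow> t \<notin> X \<longrightarrow> net m src dst f X = a + of_bool (v \<in> X)) \<and>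
     (\<forall>x<N. 0 < mark x \<longrightarrow> mark x \<le> mark v \<longrightarrow> x \<noteq> s \<longrightarrow>
       (\<exists>u<N. par x < m \<and> residual src dst f (par x) u x \<and> 0 < mark u \<and> mark u < mark x))"

lemma partial_augmentation_step:
  assumes "partial_augmentation N m src dst s t mark par a f v" "v \<noteq> s"
  defines "u \<equiv> if f (par v) = 0 then src (par v) else dst (par v)"
  shows "partial_augmentation N m src dst s t mark par a (f(par v := 1 - f (par v))) u"
    and "mark u < mark v"
proof -
  let ?e = "par v"
  obtain u' where "u' < N" and e: "?e < m" and r: "residual src dst f ?e u' v"
    and "0 < mark u'" "mark u' < mark v"
    using assms by (auto simp: partial_augmentation_def)
  moreover have "u' = u" using r by (auto simp: u_def residual_def)
  ultimately have u: "u < N" "0 < mark u" "mark u < mark v" and r: "residual src dst f ?e u v" by auto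
  show "mark u < mark v" by fact
  show "partial_augmentation N m src dst s t mark par a (f(?e := 1 - f ?e)) u"
    unfolding partial_augmentation_def
  proof (intro conjI allI impI u)
    fix X assume "s \<in> X" "t \<notin> X"
    then show "net m src dst (f(?e := 1 - f ?e)) X = a + of_bool (u \<in> X)"
      using assms(1) net_push[OF e r] by (simp add: partial_augmentation_def)
  next
    fix x assume x: "x < N" "0 < mark x" "mark x \<le> mark u" "x \<noteq> s"
    then have "mark x \<le> mark v" using u by simp
    then obtain y where y: "y < N" "par x < m" "residual src dst f (par x) y x" "0 < mark y" "mark y < mark x"
      using assms(1) x unfolding partial_augmentation_def by blast
    \<comment> \<open>Pushing changes the residual direction of the arc \<open>?e\<close> alone. The
      direction before the push fixes its head as \<open>v\<close>, whose mark exceeds that of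
      \<open>x\<close>, so the tree arcs still to be used remain residual.\<close>
    have "par x \<noteq> ?e"
    proof
      assume "par x = ?e"
      then have "x = v \<or> x = u \<and> y = v" using y r by (auto simp: residual_def)
      then show False using x y u by auto
    qed
    then show "\<exists>y<N. par x < m \<and> residual src dst (f(?e := 1 - f ?e)) (par x) y x \<and> 0 < mark y \<and> mark y < mark x"
      using y residual_push by blast
  qed
qed

section \<open>Search in the residual graph\<close>

abbreviation Zero :: "nexp \<Rightarrow> bexp" where "Zero a \<equiv> NLess a (NConst 1)"
abbreviation Pos :: "nexp \<Rightarrow> bexp" where "Pos a \<equiv> NLess (NConst 0) a"

definition visit :: "nexp \<Rightarrow> nexp \<Rightarrow> com" where
  "visit a b = Seq (NSet ''mark'' b (NAdd (NGet ''mark'' a) (NConst 1)))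
     (Seq (NSet ''par'' b (Var ''i'')) (NSet ''change'' (NConst 0) (NConst 1)))"

definition scan :: com where
  "scan =
     (let f = NGet ''flow'' (Var ''i''); a = NGet ''src'' (Var ''i''); b = NGet ''dst'' (Var ''i'')
      in Cond (BAnd (Zero f) (BAnd (Pos (NGet ''mark'' a)) (Zero (NGet ''mark'' b)))) (visit a b)
        (Cond (BAnd (Pos f) (BAnd (Pos (NGet ''mark'' b)) (Zero (NGet ''mark'' a)))) (visit b a) Skip))"

text \<open>Sweeps over all arcs until nothing changes take the place of a queue. Mark 0 means
  unreached, so the source starts with mark 1.\<close>

definition search :: com where
  "search =
     Seq (For ''i'' (NAdd (Var ''n'') (NConst 2)) (NSet ''mark'' (Var ''i'') (NConst 0)))
    (Seq (NSet ''mark'' (Var ''n'') (NConst 1))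
    (Seq (NSet ''change'' (NConst 0) (NConst 1))
     (While (Pos (Var ''change'')) (Seq (NSet ''change'' (NConst 0) (NConst 0)) (For ''i'' (Var ''m'') scan)))))"

lemma runs_scan:
  assumes tree: "search_tree N m src dst f s (nmem \<sigma> ''mark'') (nmem \<sigma> ''par'')"
    and mem: "nmem \<sigma> ''src'' = src" "nmem \<sigma> ''dst'' = dst" "nmem \<sigma> ''flow'' = f"
    and i: "nmem \<sigma> ''i'' 0 = i" "i < m" "src i < N" "dst i < N"
  shows "runs scan \<sigma> 9 (\<lambda>\<tau>.
    search_tree N m src dst f s (nmem \<tau> ''mark'') (nmem \<tau> ''par'') \<and>
    (nmem \<tau> ''mark'' = nmem \<sigma> ''mark'' \<and> nmem \<tau> ''change'' = nmem \<sigma> ''change'' \<and>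
       (\<forall>u v. residual src dst f i u v \<longrightarrow> 0 < nmem \<tau> ''mark'' u \<longrightarrow> 0 < nmem \<tau> ''mark'' v) \<or>
     nmem \<tau> ''change'' 0 = 1 \<and>
       card {x. x < N \<and> nmem \<tau> ''mark'' x = 0} < card {x. x < N \<and> nmem \<sigma> ''mark'' x = 0}))"
    (is "runs _ _ _ ?Q")
proof (rule runs_loop_free)
  let ?\<mu> = "nmem \<sigma> ''mark''"
  consider (forward) "f i = 0" "0 < ?\<mu> (src i)" "?\<mu> (dst i) = 0"
    | (backward) "0 < f i" "0 < ?\<mu> (dst i)" "?\<mu> (src i) = 0"
    | (none) "\<not> (f i = 0 \<and> 0 < ?\<mu> (src i) \<and> ?\<mu> (dst i) = 0)" "\<not> (0 < f i \<and> 0 < ?\<mu> (dst i) \<and> ?\<mu> (src i) = 0)"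
    by argo
  then show "?Q (eff scan \<sigma>)"
  proof cases
    case forward
    have "residual src dst f i (src i) (dst i)" using forward by (simp add: residual_def)
    from search_tree_grow[OF tree i(2) this i(3,4)] forward
    show ?thesis using mem i by (simp add: scan_def visit_def Let_def)
  next
    case backward
    have "residual src dst f i (dst i) (src i)" using backward by (simp add: residual_def)
    from search_tree_grow[OF tree i(2) this i(4,3)] backward
    show ?thesis using mem i by (simp add: scan_def visit_def Let_def)
  next
    case none
    have "eff scan \<sigma> = \<sigma>" using none mem i by (auto simp: scan_def Let_def)
    then show ?thesis using none tree by (auto simp: residual_def)
  qed
qed (simp_all add: scan_def visit_def Let_def)

text \<open>Costs keep the shape in which the program rules produce them, so that they unify without
  arithmetic.\<close>

definition search_cost :: "nat \<Rightarrow> nat \<Rightarrow> nat" where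
  "search_cost n m = (2 + (n + 2) * (1 + 2)) + (1 + (1 + (1 + (n + 3) * ((1 + (2 + m * (9 + 2))) + 1))))"

lemma runs_search:
  assumes mem: "nmem \<sigma> ''n'' 0 = n" "nmem \<sigma> ''m'' 0 = m"
    "nmem \<sigma> ''src'' = src" "nmem \<sigma> ''dst'' = dst" "nmem \<sigma> ''flow'' = f"
    and bounds: "\<And>e. e < m \<Longrightarrow> src e < n + 2 \<and> dst e < n + 2"
  shows "runs search \<sigma> (search_cost n m) (\<lambda>\<tau>.
    search_tree (n + 2) m src dst f n (nmem \<tau> ''mark'') (nmem \<tau> ''par'') \<and>
    (\<forall>e<m. \<forall>u v. residual src dst f e u v \<longrightarrow> 0 < nmem \<tau> ''mark'' u \<longrightarrow> 0 < nmem \<tau> ''mark'' v))"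
proof -
  let ?W = "{''mark'', ''par'', ''change'', ''i''}"
  let ?tree = "\<lambda>\<tau>. search_tree (n + 2) m src dst f n (nmem \<tau> ''mark'') (nmem \<tau> ''par'')"
  let ?closed = "\<lambda>j \<tau>. \<forall>e<j. \<forall>u v. residual src dst f e u v \<longrightarrow>
    0 < nmem \<tau> ''mark'' u \<longrightarrow> 0 < nmem \<tau> ''mark'' v"
  let ?un = "\<lambda>\<tau>. card {x. x < n + 2 \<and> nmem \<tau> ''mark'' x = 0}"
  \<comment> \<open>The flag adds one to the measure because the last sweep marks no vertex and
    lowers only the flag. Initially the measure is at most \<open>(n + 2) + 1\<close>, which
    explains \<open>n + 3\<close> in the cost.\<close>
  let ?I = "\<lambda>k \<tau>. ?tree \<tau> \<and> (nmem \<tau> ''change'' 0 = 0 \<longrightarrow> ?closed m \<tau>) \<and>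
    ?un \<tau> + of_bool (0 < nmem \<tau> ''change'' 0) \<le> k"
  have writes_scan: "writes scan = {''mark'', ''par'', ''change''}"
    by (auto simp: scan_def visit_def Let_def)
  have frame: "nmem \<tau> ''n'' 0 = n" "nmem \<tau> ''m'' 0 = m" "nmem \<tau> ''src'' = src"
      "nmem \<tau> ''dst'' = dst" "nmem \<tau> ''flow'' = f" if "agree ?W \<sigma> \<tau>" for \<tau>
    using mem that by (simp_all add: agree_nmem)
  have loop: "runs (While (Pos (Var ''change'')) (Seq (NSet ''change'' (NConst 0) (NConst 0)) (For ''i'' (Var ''m'') scan)))
      \<tau> (1 + (n + 3) * ((1 + (2 + m * (9 + 2))) + 1)) (\<lambda>\<tau>'. ?tree \<tau>' \<and> ?closed m \<tau>')"
    if I: "?I (n + 3) \<tau>" and a: "agree ?W \<sigma> \<tau>" for \<tau>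
  proof (rule runs_While[where I = ?I])
    fix k \<upsilon>
    assume I: "?I k \<upsilon>" and "agree (writes (Seq (NSet ''change'' (NConst 0) (NConst 0)) (For ''i'' (Var ''m'') scan))) \<tau> \<upsilon>"
    then have "agree ?W \<tau> \<upsilon>" by (auto simp: writes_scan insert_commute)
    with a have a: "agree ?W \<sigma> \<upsilon>" by (rule agree_trans)
    {
      assume "\<not> bval \<upsilon> (Pos (Var ''change''))"
      then show "?tree \<upsilon> \<and> ?closed m \<upsilon>" using I by simp
    }
    assume b: "bval \<upsilon> (Pos (Var ''change''))"
    show "runs (Seq (NSet ''change'' (NConst 0) (NConst 0)) (For ''i'' (Var ''m'') scan)) \<upsilon>
        (1 + (2 + m * (9 + 2))) (\<lambda>\<tau>'. \<exists>k'<k. ?I k' \<tau>')"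
    proof (rule runs_Seq)
      \<comment> \<open>As long as the sweep has marked nothing, the marks are untouched and the
        scanned arcs stay closed. After the first new mark that claim is given up, and the flag
        forces another sweep.\<close>
      let ?J = "\<lambda>j \<tau>'. ?tree \<tau>' \<and>
        (nmem \<tau>' ''change'' 0 = 0 \<and> ?closed j \<tau>' \<and> ?un \<tau>' = ?un \<upsilon> \<or> nmem \<tau>' ''change'' 0 = 1 \<and> ?un \<tau>' < ?un \<upsilon>)"
      show "runs (NSet ''change'' (NConst 0) (NConst 0)) \<upsilon> 1 (\<lambda>\<tau>'. \<tau>' = nset ''change'' 0 0 \<upsilon>)"
        by (rule runs_NSet) simp
      fix \<phi> assume \<phi>: "\<phi> = nset ''change'' 0 0 \<upsilon>"
      have a\<phi>: "agree ?W \<sigma> \<phi>" using a \<phi> by (simp add: agree_nset)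
      show "runs (For ''i'' (Var ''m'') scan) \<phi> (2 + m * (9 + 2)) (\<lambda>\<tau>'. \<exists>k'<k. ?I k' \<tau>')"
      proof (rule runs_For[where I = ?J])
        show "?J 0 (nset ''i'' 0 0 \<phi>)" using I \<phi> by simp
        show "''i'' \<notin> writes scan" by (simp add: writes_scan)
      next
        fix \<psi> assume "agree (insert ''i'' (writes scan)) \<phi> \<psi>"
        then have "agree ?W \<phi> \<psi>" by (simp add: writes_scan insert_commute)
        with a\<phi> have "agree ?W \<sigma> \<psi>" by (rule agree_trans)
        then show "nval \<psi> (Var ''m'') = m" using frame by simp
      next
        fix j \<psi> assume J: "?J j \<psi>" and "agree (insert ''i'' (writes scan)) \<phi> \<psi>" and j: "nmem \<psi> ''i'' 0 = j" "j < m"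
        then have "agree ?W \<phi> \<psi>" by (simp add: writes_scan insert_commute)
        with a\<phi> have "agree ?W \<sigma> \<psi>" by (rule agree_trans)
        note fr = frame[OF this]
        have "?tree \<psi>" using J by blast
        from runs_scan[OF this fr(3-5) j bounds[OF j(2), THEN conjunct1] bounds[OF j(2), THEN conjunct2]]
        show "runs scan \<psi> 9 (\<lambda>\<tau>'. ?J (Suc j) (nset ''i'' 0 (Suc j) \<tau>'))"
          by (rule runs_mono) (use J in \<open>auto simp: less_Suc_eq\<close>)
      next
        fix \<psi> assume J: "?J m \<psi>"
        show "\<exists>k'<k. ?I k' \<psi>"
          by (rule exI[of _ "?un \<psi> + of_bool (0 < nmem \<psi> ''change'' 0)"]) (use J I b in auto)
      qed
    qed
  qed (use I in auto)
  show ?thesis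
    unfolding search_def search_cost_def
  proof (rule runs_Seq, rule runs_clear[where N = "n + 2"])
    fix \<tau> assume "agree {''mark'', ''i''} \<sigma> \<tau>"
    then show "nval \<tau> (NAdd (Var ''n'') (NConst 2)) = n + 2" using mem by (simp add: agree_nmem)
  next
    fix \<tau> :: state
    assume zero: "\<forall>v<n + 2. nmem \<tau> ''mark'' v = 0"
      and "agree (writes (For ''i'' (NAdd (Var ''n'') (NConst 2)) (NSet ''mark'' (Var ''i'') (NConst 0)))) \<sigma> \<tau>"
    then have \<tau>: "(\<forall>v<n + 2. nmem \<tau> ''mark'' v = 0) \<and> agree ?W \<sigma> \<tau>"
      using agree_mono[of _ \<sigma> \<tau> ?W] by simp
    have "runs (NSet ''change'' (NConst 0) (NConst 1)) (nset ''mark'' n 1 \<tau>) 1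
        (\<lambda>\<tau>'. \<tau>' = nset ''change'' 0 1 (nset ''mark'' n 1 \<tau>))"
      by (rule runs_NSet) simp
    moreover have "?I (n + 3) (nset ''change'' 0 1 (nset ''mark'' n 1 \<tau>))"
    proof -
      have "{x. x < n + 2 \<and> 0 < ((nmem \<tau> ''mark'')(n := 1)) x} = {n}" using \<tau> by auto
      moreover have "card {x. x < n + 2 \<and> ((nmem \<tau> ''mark'')(n := 1)) x = 0} \<le> card {..<n + 2}"
        by (rule card_mono) auto
      ultimately show ?thesis using \<tau> by (simp add: search_tree_def)
    qed
    moreover have "agree ?W \<sigma> (nset ''change'' 0 1 (nset ''mark'' n 1 \<tau>))"
      using \<tau> by (intro agree_nset) auto
    ultimately show "runs (Seq (NSet ''mark'' (Var ''n'') (NConst 1)) (Seq (NSet ''change'' (NConst 0) (NConst 1))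
        (While (Pos (Var ''change'')) (Seq (NSet ''change'' (NConst 0) (NConst 0)) (For ''i'' (Var ''m'') scan))))) \<tau>
        (1 + (1 + (1 + (n + 3) * ((1 + (2 + m * (9 + 2))) + 1)))) (\<lambda>\<tau>'. ?tree \<tau>' \<and> ?closed m \<tau>')"
      using \<tau> frame(1) loop
      by (intro runs_Seq[where R = "\<lambda>\<tau>'. \<tau>' = nset ''mark'' n 1 \<tau>"]
          runs_Seq[where R = "\<lambda>\<tau>'. \<tau>' = nset ''change'' 0 1 (nset ''mark'' n 1 \<tau>)"] runs_NSet) auto
  qed auto
qed

section \<open>Augmentation along the search tree\<close>

definition augment :: com where
  "augment =
     Seq (NSet ''v'' (NConst 0) (NAdd (Var ''n'') (NConst 1)))
     (While (BNot (BAnd (BNot (NLess (Var ''v'') (Var ''n''))) (BNot (NLess (Var ''n'') (Var ''v'')))))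
       (Seq (NSet ''e'' (NConst 0) (NGet ''par'' (Var ''v'')))
         (Cond (Zero (NGet ''flow'' (Var ''e'')))
           (Seq (NSet ''flow'' (Var ''e'') (NConst 1)) (NSet ''v'' (NConst 0) (NGet ''src'' (Var ''e''))))
           (Seq (NSet ''flow'' (Var ''e'') (NConst 0)) (NSet ''v'' (NConst 0) (NGet ''dst'' (Var ''e'')))))))"

definition is_flow :: "nat \<Rightarrow> (nat \<Rightarrow> nat) \<Rightarrow> (nat \<Rightarrow> nat) \<Rightarrow> nat \<Rightarrow> nat \<Rightarrow> (nat \<Rightarrow> nat) \<Rightarrow> nat \<Rightarrow> bool" where
  "is_flow m src dst s t f a \<longleftrightarrow> (\<forall>X. s \<in> X \<longrightarrow> t \<notin> X \<longrightarrow> net m src dst f X = int a) \<and> (\<forall>e<m. f e \<le> 1)"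

text \<open>The arcs leaving \<open>s\<close> already form a separating cut; this limits the number
  of augmentations.\<close>

lemma is_flow_le:
  assumes "is_flow m src dst s t f a" "s \<noteq> t"
  shows "a \<le> m"
proof -
  have "int a = net m src dst f {s}" using assms by (simp add: is_flow_def)
  then show ?thesis using net_le_cut[of m src dst f "{s}"] card_cut_le[of m src dst "{s}"] by linarith
qed

lemma runs_augment:
  assumes mem: "nmem \<sigma> ''n'' 0 = n" "nmem \<sigma> ''src'' = src" "nmem \<sigma> ''dst'' = dst"
    and flow: "is_flow m src dst n (n + 1) (nmem \<sigma> ''flow'') a"
    and tree: "search_tree (n + 2) m src dst (nmem \<sigma> ''flow'') n (nmem \<sigma> ''mark'') (nmem \<sigma> ''par'')"
    and reached: "0 < nmem \<sigma> ''mark'' (n + 1)"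
  shows "runs augment \<sigma> (1 + (1 + (n + 2) * (6 + 1)))
    (\<lambda>\<tau>. is_flow m src dst n (n + 1) (nmem \<tau> ''flow'') (Suc a))"
  unfolding augment_def
proof (rule runs_Seq)
  define \<mu> par where "\<mu> = nmem \<sigma> ''mark''" and "par = nmem \<sigma> ''par''"
  let ?\<sigma>' = "nset ''v'' 0 (n + 1) \<sigma>"
  show "runs (NSet ''v'' (NConst 0) (NAdd (Var ''n'') (NConst 1))) \<sigma> 1 (\<lambda>\<tau>. \<tau> = ?\<sigma>')"
    by (rule runs_NSet) (simp add: mem)
  let ?b = "BNot (BAnd (BNot (NLess (Var ''v'') (Var ''n''))) (BNot (NLess (Var ''n'') (Var ''v''))))"
  let ?c = "Seq (NSet ''e'' (NConst 0) (NGet ''par'' (Var ''v'')))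
         (Cond (Zero (NGet ''flow'' (Var ''e'')))
           (Seq (NSet ''flow'' (Var ''e'') (NConst 1)) (NSet ''v'' (NConst 0) (NGet ''src'' (Var ''e''))))
           (Seq (NSet ''flow'' (Var ''e'') (NConst 0)) (NSet ''v'' (NConst 0) (NGet ''dst'' (Var ''e'')))))"
  let ?PA = "partial_augmentation (n + 2) m src dst n (n + 1) \<mu> par (int a)"
  \<comment> \<open>The mark of the current vertex bounds the remaining walk: it falls with each
    step and starts below the number of marked vertices. At the sink the extra unit is seen by no
    separating cut, at the source by all of them.\<close>
  let ?I = "\<lambda>k \<tau>. ?PA (nmem \<tau> ''flow'') (nmem \<tau> ''v'' 0) \<and>
    (\<forall>e<m. nmem \<tau> ''flow'' e \<le> 1) \<and> \<mu> (nmem \<tau> ''v'' 0) \<le> k"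
  have "runs (While ?b ?c) ?\<sigma>' (1 + (n + 2) * (6 + 1))
      (\<lambda>\<tau>. is_flow m src dst n (n + 1) (nmem \<tau> ''flow'') (Suc a))"
  proof (rule runs_While[where I = ?I])
    have "\<mu> (n + 1) \<le> card {x. x < n + 2 \<and> 0 < \<mu> x}" using tree by (simp add: search_tree_def \<mu>_def)
    also have "\<dots> \<le> card {..<n + 2}" by (rule card_mono) auto
    finally have "\<mu> (n + 1) \<le> n + 2" by simp
    then show "?I (n + 2) ?\<sigma>'"
      using flow tree reached
      by (auto simp: partial_augmentation_def is_flow_def search_tree_def \<mu>_def par_def)
  next
    fix k \<tau> assume I: "?I k \<tau>" and a: "agree (writes ?c) ?\<sigma>' \<tau>"
    have fr: "nmem \<tau> ''n'' 0 = n" "nmem \<tau> ''src'' = src" "nmem \<tau> ''dst'' = dst" "nmem \<tau> ''par'' = par"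
      using a mem by (simp_all add: agree_nmem par_def)
    {
      assume "\<not> bval \<tau> ?b"
      then have "nmem \<tau> ''v'' 0 = n" using fr by simp
      then show "is_flow m src dst n (n + 1) (nmem \<tau> ''flow'') (Suc a)"
        using I by (simp add: partial_augmentation_def is_flow_def)
    }
    define v f where "v = nmem \<tau> ''v'' 0" and "f = nmem \<tau> ''flow''"
    define u where "u = (if f (par v) = 0 then src (par v) else dst (par v))"
    assume b: "bval \<tau> ?b"
    then have v: "v \<noteq> n" using fr by (auto simp: v_def)
    have PA: "?PA f v" and f: "\<forall>e<m. f e \<le> 1" and k: "\<mu> v \<le> k" using I by (simp_all add: v_def f_def)
    note step = partial_augmentation_step[OF PA v, folded u_def]
    have "0 < \<mu> v" "v < n + 2" using PA by (simp_all add: partial_augmentation_def)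
    then have "par v < m" using PA v by (auto simp: partial_augmentation_def)
    then have "f (par v) = 0 \<or> f (par v) = 1" using f by (auto simp: le_Suc_eq)
    then have eff: "nmem (eff ?c \<tau>) ''flow'' = f(par v := 1 - f (par v))" "nmem (eff ?c \<tau>) ''v'' 0 = u"
      using fr by (auto simp: u_def v_def f_def)
    show "runs ?c \<tau> 6 (\<lambda>\<tau>'. \<exists>k'<k. ?I k' \<tau>')"
    proof (rule runs_loop_free)
      show "\<exists>k'<k. ?I k' (eff ?c \<tau>)"
        unfolding eff using step f k by (intro exI[of _ "\<mu> u"]) auto
    qed auto
  qed
  then show "runs (While ?b ?c) \<tau> (1 + (n + 2) * (6 + 1))
      (\<lambda>\<tau>. is_flow m src dst n (n + 1) (nmem \<tau> ''flow'') (Suc a))" if "\<tau> = ?\<sigma>'" for \<tau>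
    using that by simp
qed

section \<open>Maximum flow and the resulting minimum cut\<close>

definition max_flow :: com where
  "max_flow =
     Seq (For ''i'' (Var ''m'') (NSet ''flow'' (Var ''i'') (NConst 0)))
    (Seq (NSet ''go'' (NConst 0) (NConst 1))
     (While (Pos (Var ''go''))
       (Seq search (Cond (Pos (NGet ''mark'' (NAdd (Var ''n'') (NConst 1)))) augment
         (NSet ''go'' (NConst 0) (NConst 0))))))"

definition max_flow_cost :: "nat \<Rightarrow> nat \<Rightarrow> nat" where
  "max_flow_cost n m = (2 + m * (1 + 2)) +
     (1 + (1 + (m + 1) * ((search_cost n m + Suc (1 + (1 + (n + 2) * (6 + 1)))) + 1)))"

lemma writes_search: "writes search = {''mark'', ''par'', ''change'', ''i''}"
  by (auto simp: search_def scan_def visit_def Let_def)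

lemma writes_max_flow: "writes max_flow = {''i'', ''flow'', ''go'', ''mark'', ''par'', ''change'', ''v'', ''e''}"
  by (auto simp: max_flow_def augment_def writes_search)

text \<open>The flow is exported merely as a certificate. The result proper is the set of marked
  vertices left by the last, unsuccessful search.\<close>

lemma runs_max_flow:
  assumes mem: "nmem \<sigma> ''n'' 0 = n" "nmem \<sigma> ''m'' 0 = m"
    "nmem \<sigma> ''src'' = src" "nmem \<sigma> ''dst'' = dst"
    and bounds: "\<And>e. e < m \<Longrightarrow> src e < n + 2 \<and> dst e < n + 2"
  shows "runs max_flow \<sigma> (max_flow_cost n m) (\<lambda>\<tau>. \<exists>f a.
    is_flow m src dst n (n + 1) f a \<and> 0 < nmem \<tau> ''mark'' n \<and> nmem \<tau> ''mark'' (n + 1) = 0 \<and>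
    (\<forall>e<m. \<forall>u v. residual src dst f e u v \<longrightarrow> 0 < nmem \<tau> ''mark'' u \<longrightarrow> 0 < nmem \<tau> ''mark'' v))"
  (is "runs _ _ _ ?Q")
proof -
  let ?body = "Seq search (Cond (Pos (NGet ''mark'' (NAdd (Var ''n'') (NConst 1)))) augment
         (NSet ''go'' (NConst 0) (NConst 0)))"
  let ?flow = "\<lambda>\<tau>. is_flow m src dst n (n + 1) (nmem \<tau> ''flow'')"
  let ?W = "{''i'', ''flow'', ''go'', ''mark'', ''par'', ''change'', ''v'', ''e''}"
  \<comment> \<open>The value of the flow never exceeds \<open>m\<close>; starting from
    \<open>m + 1\<close> leaves one round for the search that fails.\<close>
  let ?I = "\<lambda>k \<tau>. 0 < nmem \<tau> ''go'' 0 \<and> (\<exists>a. ?flow \<tau> a \<and> a + k = m + 1) \<or> nmem \<tau> ''go'' 0 = 0 \<and> ?Q \<tau>"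
  have frame: "nmem \<tau> ''n'' 0 = n" "nmem \<tau> ''m'' 0 = m" "nmem \<tau> ''src'' = src" "nmem \<tau> ''dst'' = dst"
    if "agree ?W \<sigma> \<tau>" for \<tau>
    using mem that by (simp_all add: agree_nmem)
  have writes_body: "writes ?body \<subseteq> ?W" by (auto simp: augment_def writes_search)
  have loop: "runs (While (Pos (Var ''go'')) ?body) \<tau>
      (1 + (m + 1) * ((search_cost n m + Suc (1 + (1 + (n + 2) * (6 + 1)))) + 1)) ?Q"
    if I: "?I (m + 1) \<tau>" and a: "agree ?W \<sigma> \<tau>" for \<tau>
  proof (rule runs_While[where I = ?I])
    fix k \<upsilon> assume I: "?I k \<upsilon>" and w: "agree (writes ?body) \<tau> \<upsilon>"
    have a: "agree ?W \<sigma> \<upsilon>" using a agree_mono[OF w writes_body] by (rule agree_trans)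
    note fr = frame[OF a]
    {
      assume "\<not> bval \<upsilon> (Pos (Var ''go''))"
      then show "?Q \<upsilon>" using I by simp
    }
    assume "bval \<upsilon> (Pos (Var ''go''))"
    then obtain c where c: "?flow \<upsilon> c" "c + k = m + 1" using I by auto
    have "c \<le> m" using is_flow_le[OF c(1)] by simp
    then have k: "0 < k" using c(2) by simp
    define f where "f = nmem \<upsilon> ''flow''"
    show "runs ?body \<upsilon> (search_cost n m + Suc (1 + (1 + (n + 2) * (6 + 1)))) (\<lambda>\<tau>'. \<exists>k'<k. ?I k' \<tau>')"
    proof (rule runs_Seq[OF runs_search[OF fr f_def[symmetric] bounds]], assumption, rule runs_Cond)
      fix \<phi>
      assume S: "search_tree (n + 2) m src dst f n (nmem \<phi> ''mark'') (nmem \<phi> ''par'') \<and>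
        (\<forall>e<m. \<forall>u v. residual src dst f e u v \<longrightarrow> 0 < nmem \<phi> ''mark'' u \<longrightarrow> 0 < nmem \<phi> ''mark'' v)"
        and aS: "agree (writes search) \<upsilon> \<phi>"
      have \<phi>: "nmem \<phi> ''n'' 0 = n" "nmem \<phi> ''src'' = src" "nmem \<phi> ''dst'' = dst" "nmem \<phi> ''flow'' = f"
        "nmem \<phi> ''go'' = nmem \<upsilon> ''go''"
        using aS fr by (simp_all add: agree_nmem writes_search f_def)
      {
        assume b: "bval \<phi> (Pos (NGet ''mark'' (NAdd (Var ''n'') (NConst 1))))"
        have "runs augment \<phi> (1 + (1 + (n + 2) * (6 + 1))) (\<lambda>\<tau>. ?flow \<tau> (Suc c))"
          using b S c \<phi> by (intro runs_augment) (auto simp: f_def)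
        then show "runs augment \<phi> (1 + (1 + (n + 2) * (6 + 1))) (\<lambda>\<tau>'. \<exists>k'<k. ?I k' \<tau>')"
        proof (rule runs_mono)
          fix \<psi> assume F: "?flow \<psi> (Suc c)" and "agree (writes augment) \<phi> \<psi>"
          then have "nmem \<psi> ''go'' = nmem \<upsilon> ''go''" using \<phi> by (simp add: agree_nmem augment_def)
          then show "\<exists>k'<k. ?I k' \<psi>"
            using F c k \<open>bval \<upsilon> (Pos (Var ''go''))\<close>
            by (intro exI[of _ "k - 1"] conjI disjI1 exI[of _ "Suc c"]) auto
        qed simp
      }
      {
        assume b: "\<not> bval \<phi> (Pos (NGet ''mark'' (NAdd (Var ''n'') (NConst 1))))"
        have "?Q (nset ''go'' 0 0 \<phi>)"
          using b S c(1) \<phi> by (intro exI[of _ f] exI[of _ c]) (auto simp: f_def search_tree_def)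
        then have "?I 0 (nset ''go'' 0 0 \<phi>)" by simp
        then have "runs (NSet ''go'' (NConst 0) (NConst 0)) \<phi> 1 (\<lambda>\<tau>'. \<exists>k'<k. ?I k' \<tau>')"
          using k by (intro runs_NSet exI[of _ 0]) simp
        then show "runs (NSet ''go'' (NConst 0) (NConst 0)) \<phi> (1 + (1 + (n + 2) * (6 + 1)))
            (\<lambda>\<tau>'. \<exists>k'<k. ?I k' \<tau>')"
          by (rule runs_mono) auto
      }
    qed
  qed (use I in auto)
  show ?thesis
    unfolding max_flow_def max_flow_cost_def
  proof (rule runs_Seq, rule runs_clear[where N = m])
    fix \<tau> assume "agree {''flow'', ''i''} \<sigma> \<tau>"
    then show "nval \<tau> (Var ''m'') = m" using mem by (simp add: agree_nmem)
  next
    fix \<tau> :: state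
    assume "\<forall>e<m. nmem \<tau> ''flow'' e = 0"
      and "agree (writes (For ''i'' (Var ''m'') (NSet ''flow'' (Var ''i'') (NConst 0)))) \<sigma> \<tau>"
    then have \<tau>: "(\<forall>e<m. nmem \<tau> ''flow'' e = 0) \<and> agree ?W \<sigma> \<tau>"
      using agree_mono[of _ \<sigma> \<tau> ?W] by simp
    have "?I (m + 1) (nset ''go'' 0 1 \<tau>)"
      using \<tau> by (intro disjI1 conjI exI[of _ 0]) (auto simp: is_flow_def net_def)
    moreover have "agree ?W \<sigma> (nset ''go'' 0 1 \<tau>)"
      using \<tau> by (intro agree_nset) auto
    ultimately show "runs (Seq (NSet ''go'' (NConst 0) (NConst 1)) (While (Pos (Var ''go'')) ?body)) \<tau>
        (1 + (1 + (m + 1) * ((search_cost n m + Suc (1 + (1 + (n + 2) * (6 + 1)))) + 1))) ?Q"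
      using loop by (intro runs_Seq[where R = "\<lambda>\<tau>'. \<tau>' = nset ''go'' 0 1 \<tau>"] runs_NSet) auto
  qed auto
qed

definition min_cut :: com where
  "min_cut = Seq max_flow (For ''i'' (Var ''m'')
     (Cond (BAnd (Pos (NGet ''mark'' (NGet ''src'' (Var ''i'')))) (Zero (NGet ''mark'' (NGet ''dst'' (Var ''i'')))))
       (NSet ''out'' (Var ''i'') (NConst 1)) (NSet ''out'' (Var ''i'') (NConst 0))))"

definition min_cut_cost :: "nat \<Rightarrow> nat \<Rightarrow> nat" where
  "min_cut_cost n m = max_flow_cost n m + (2 + m * (3 + 2))"

text \<open>The cut of the marked set has the size of the flow value, which is a lower bound for
  every separating cut.\<close>

lemma runs_min_cut:
  assumes mem: "nmem \<sigma> ''n'' 0 = n" "nmem \<sigma> ''m'' 0 = m"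
    "nmem \<sigma> ''src'' = src" "nmem \<sigma> ''dst'' = dst"
    and bounds: "\<And>e. e < m \<Longrightarrow> src e < n + 2 \<and> dst e < n + 2"
  shows "runs min_cut \<sigma> (min_cut_cost n m) (\<lambda>\<tau>. \<exists>X. n \<in> X \<and> n + 1 \<notin> X \<and>
    (\<forall>e<m. nmem \<tau> ''out'' e \<noteq> 0 \<longleftrightarrow> e \<in> cut m src dst X) \<and>
    (\<forall>Y. n \<in> Y \<longrightarrow> n + 1 \<notin> Y \<longrightarrow> card (cut m src dst X) \<le> card (cut m src dst Y)))"
  unfolding min_cut_def min_cut_cost_def
proof (rule runs_Seq[OF runs_max_flow[OF mem bounds]], assumption, elim exE conjE)
  fix \<tau> f a
  assume agr: "agree (writes max_flow) \<sigma> \<tau>" and flow: "is_flow m src dst n (n + 1) f a"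
    and st: "0 < nmem \<tau> ''mark'' n" "nmem \<tau> ''mark'' (n + 1) = 0"
    and closed: "\<forall>e<m. \<forall>u v. residual src dst f e u v \<longrightarrow> 0 < nmem \<tau> ''mark'' u \<longrightarrow> 0 < nmem \<tau> ''mark'' v"
  let ?mark = "nmem \<tau> ''mark''"
  \<comment> \<open>Cells beyond \<open>n + 1\<close> may put stray numbers into this set, but no
    arc has an end there.\<close>
  let ?X = "{v. 0 < ?mark v}"
  have fr: "nmem \<tau> ''m'' 0 = m" "nmem \<tau> ''src'' = src" "nmem \<tau> ''dst'' = dst"
    using agr mem by (simp_all add: agree_nmem writes_max_flow)
  have "net m src dst f ?X = int (card (cut m src dst ?X))"
    using closed by (intro net_eq_cut) auto
  then have a: "card (cut m src dst ?X) = a"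
    using flow st by (simp add: is_flow_def)
  have min: "card (cut m src dst ?X) \<le> card (cut m src dst Y)" if "n \<in> Y" "n + 1 \<notin> Y" for Y
    using net_le_cut[of m src dst f Y] flow that a by (simp add: is_flow_def)
  show "runs (For ''i'' (Var ''m'')
     (Cond (BAnd (Pos (NGet ''mark'' (NGet ''src'' (Var ''i'')))) (Zero (NGet ''mark'' (NGet ''dst'' (Var ''i'')))))
       (NSet ''out'' (Var ''i'') (NConst 1)) (NSet ''out'' (Var ''i'') (NConst 0)))) \<tau> (2 + m * (3 + 2))
     (\<lambda>\<tau>. \<exists>X. n \<in> X \<and> n + 1 \<notin> X \<and>
    (\<forall>e<m. nmem \<tau> ''out'' e \<noteq> 0 \<longleftrightarrow> e \<in> cut m src dst X) \<and>
    (\<forall>Y. n \<in> Y \<longrightarrow> n + 1 \<notin> Y \<longrightarrow> card (cut m src dst X) \<le> card (cut m src dst Y)))"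
    (is "runs (For _ _ ?c) _ _ ?Q")
  proof (rule runs_For[where I = "\<lambda>j \<upsilon>. \<forall>e<j. nmem \<upsilon> ''out'' e \<noteq> 0 \<longleftrightarrow> 0 < ?mark (src e) \<and> ?mark (dst e) = 0"])
    fix \<upsilon> assume "agree (insert ''i'' (writes ?c)) \<tau> \<upsilon>"
    then show "nval \<upsilon> (Var ''m'') = m" using fr by (simp add: agree_nmem)
  next
    fix j \<upsilon>
    assume I: "\<forall>e<j. (nmem \<upsilon> ''out'' e \<noteq> 0) = (0 < ?mark (src e) \<and> ?mark (dst e) = 0)"
      and "agree (insert ''i'' (writes ?c)) \<tau> \<upsilon>" and j: "nmem \<upsilon> ''i'' 0 = j"
    then have "nmem \<upsilon> ''mark'' = ?mark" "nmem \<upsilon> ''src'' = src" "nmem \<upsilon> ''dst'' = dst"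
      using fr by (simp_all add: agree_nmem)
    then show "runs ?c \<upsilon> 3 (\<lambda>\<tau>'. \<forall>e<Suc j. (nmem (nset ''i'' 0 (Suc j) \<tau>') ''out'' e \<noteq> 0) =
        (0 < ?mark (src e) \<and> ?mark (dst e) = 0))"
      using I j by (intro runs_loop_free) (auto simp: less_Suc_eq)
  next
    fix \<upsilon> :: state
    assume "\<forall>e<m. (nmem \<upsilon> ''out'' e \<noteq> 0) = (0 < ?mark (src e) \<and> ?mark (dst e) = 0)"
    then show "?Q \<upsilon>" using st min by (intro exI[of _ ?X]) (auto simp: cut_def)
  qed auto
qed

section \<open>Potentials and contraction of the path\<close>

text \<open>The model has no real constants, so zero is obtained by subtracting a cell from
  itself.\<close>

definition mark_path :: com where
  "mark_path =
     Seq (For ''i'' (Var ''n'') (NSet ''on_path'' (Var ''i'') (NConst 0)))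
    (Seq (For ''i'' (Var ''m'') (NSet ''in_path'' (Var ''i'') (NConst 0)))
    (Seq (NSet ''on_path'' (Var ''s'') (NConst 1))
    (Seq (RSet ''total'' (NConst 0) (RSub (RGet ''total'' (NConst 0)) (RGet ''total'' (NConst 0))))
     (For ''i'' (Var ''len'')
       (Seq (NSet ''e'' (NConst 0) (NGet ''path'' (Var ''i'')))
       (Seq (NSet ''in_path'' (Var ''e'') (NConst 1))
       (Seq (NSet ''on_path'' (NGet ''head'' (Var ''e'')) (NConst 1))
         (RSet ''total'' (NConst 0) (RAdd (RGet ''total'' (NConst 0)) (RGet ''weight'' (Var ''e'')))))))))))"

lemma writes_mark_path: "writes mark_path = {''i'', ''on_path'', ''in_path'', ''total'', ''e''}"
  by (auto simp: mark_path_def)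

lemma runs_mark_path:
  assumes mem: "nmem \<sigma> ''n'' 0 = n" "nmem \<sigma> ''m'' 0 = m" "nmem \<sigma> ''s'' 0 = s" "nmem \<sigma> ''len'' 0 = l"
    "nmem \<sigma> ''path'' = p" "nmem \<sigma> ''head'' = hv" "rmem \<sigma> ''weight'' = wt"
  shows "runs mark_path \<sigma> ((2 + n * (1 + 2)) + ((2 + m * (1 + 2)) + (1 + (1 + (2 + l * (4 + 2))))))
    (\<lambda>\<tau>. (\<forall>v<n. 0 < nmem \<tau> ''on_path'' v \<longleftrightarrow> v = s \<or> (\<exists>i<l. hv (p i) = v)) \<and>
      (\<forall>e<m. 0 < nmem \<tau> ''in_path'' e \<longleftrightarrow> (\<exists>i<l. p i = e)) \<and>
      rmem \<tau> ''total'' 0 = (\<Sum>i<l. wt (p i)))"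
  unfolding mark_path_def
proof (rule runs_Seq, rule runs_clear[where N = n], goal_cases)
  case (3 \<tau>)
  have a3: "agree {''i'', ''on_path''} \<sigma> \<tau>" using 3(2) by (simp add: insert_commute)
  show ?case
  proof (rule runs_Seq, rule runs_clear[where N = m], goal_cases)
    case (3 \<upsilon>)
    have a: "agree {''i'', ''in_path''} \<tau> \<upsilon>" using 3(2) by (simp add: insert_commute)
    have fr: "nmem \<upsilon> ''s'' 0 = s" "nmem \<upsilon> ''len'' 0 = l" "nmem \<upsilon> ''path'' = p" "nmem \<upsilon> ''head'' = hv"
      "rmem \<upsilon> ''weight'' = wt" "nmem \<upsilon> ''on_path'' = nmem \<tau> ''on_path''"
      using mem agree_nmem[OF a] agree_rmem[OF a] agree_nmem[OF a3] agree_rmem[OF a3] by simp_all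
    let ?\<phi> = "nset ''on_path'' s 1 \<upsilon>"
    let ?\<psi> = "rset ''total'' 0 0 ?\<phi>"
    let ?c = "Seq (NSet ''e'' (NConst 0) (NGet ''path'' (Var ''i'')))
       (Seq (NSet ''in_path'' (Var ''e'') (NConst 1))
       (Seq (NSet ''on_path'' (NGet ''head'' (Var ''e'')) (NConst 1))
         (RSet ''total'' (NConst 0) (RAdd (RGet ''total'' (NConst 0)) (RGet ''weight'' (Var ''e''))))))"
    have "runs (For ''i'' (Var ''len'') ?c) ?\<psi> (2 + l * (4 + 2))
      (\<lambda>\<tau>. (\<forall>v<n. 0 < nmem \<tau> ''on_path'' v \<longleftrightarrow> v = s \<or> (\<exists>i<l. hv (p i) = v)) \<and>
      (\<forall>e<m. 0 < nmem \<tau> ''in_path'' e \<longleftrightarrow> (\<exists>i<l. p i = e)) \<and>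
      rmem \<tau> ''total'' 0 = (\<Sum>i<l. wt (p i)))"
    proof (rule runs_For[where I = "\<lambda>j \<tau>. (\<forall>v<n. 0 < nmem \<tau> ''on_path'' v \<longleftrightarrow> v = s \<or> (\<exists>i<j. hv (p i) = v)) \<and>
        (\<forall>e<m. 0 < nmem \<tau> ''in_path'' e \<longleftrightarrow> (\<exists>i<j. p i = e)) \<and>
        rmem \<tau> ''total'' 0 = (\<Sum>i<j. wt (p i))"], goal_cases)
      case 1
      show ?case using 3(1) \<open>\<forall>v<n. nmem \<tau> ''on_path'' v = 0\<close> fr by auto
    next
      case (2 \<omega>)
      show ?case using agree_nmem[OF 2] fr by simp
    next
      case (4 j \<omega>)
      have "nmem \<omega> ''path'' = p" "nmem \<omega> ''head'' = hv" "rmem \<omega> ''weight'' = wt"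
        using agree_nmem[OF 4(2)] agree_rmem[OF 4(2)] fr by simp_all
      then show ?case using 4(1,3) by (intro runs_loop_free) (auto simp: less_Suc_eq)
    qed auto
    then show ?case using fr
      by (intro runs_Seq[where R = "\<lambda>\<tau>. \<tau> = ?\<phi>"] runs_Seq[where R = "\<lambda>\<tau>. \<tau> = ?\<psi>"] runs_NSet
          runs_loop_free[of "RSet _ _ _"]) auto
  qed (use mem agree_nmem[OF a3] in \<open>auto simp: agree_nmem\<close>)
qed (use mem in \<open>auto simp: agree_nmem\<close>)

section \<open>Dijkstra's algorithm with capped labels\<close>

text \<open>
  An arbitrary potential \<open>\<pi>\<close> bounds the labels from below. This local condition replaces the usual
  invariant that every label is the cost of a walk.
\<close>

definition settled_labels :: "nat \<Rightarrow> nat \<Rightarrow> (nat \<Rightarrow> nat) \<Rightarrow> (nat \<Rightarrow> nat) \<Rightarrow> (nat \<Rightarrow> real) \<Rightarrow>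
    (nat \<Rightarrow> real) \<Rightarrow> (nat \<Rightarrow> nat) \<Rightarrow> (nat \<Rightarrow> real) \<Rightarrow> bool" where
  "settled_labels n m tv hv wt \<pi> done d \<longleftrightarrow>
     (\<forall>e<m. 0 < done (tv e) \<longrightarrow> d (hv e) \<le> d (tv e) + wt e) \<and>
     (\<forall>u<n. \<forall>v<n. 0 < done u \<longrightarrow> done v = 0 \<longrightarrow> d u \<le> d v) \<and>
     (\<forall>v<n. \<pi> v \<le> d v)"

text \<open>The state in the middle of the sweep that settles \<open>u\<close>, relative to the
  labels \<open>d\<close> and the flags \<open>done\<close> from before it: settled labels and that
  of \<open>u\<close> are frozen, and all others stay between \<open>d u\<close> and their old
  value.\<close>

definition relaxed_labels :: "nat \<Rightarrow> (nat \<Rightarrow> nat) \<Rightarrow> (nat \<Rightarrow> nat) \<Rightarrow> (nat \<Rightarrow> real) \<Rightarrow>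
    (nat \<Rightarrow> real) \<Rightarrow> (nat \<Rightarrow> nat) \<Rightarrow> (nat \<Rightarrow> real) \<Rightarrow> nat \<Rightarrow> nat \<Rightarrow> (nat \<Rightarrow> real) \<Rightarrow> bool" where
  "relaxed_labels n tv hv wt \<pi> done d u j d' \<longleftrightarrow>
     (\<forall>v<n. \<pi> v \<le> d' v \<and> d' v \<le> d v \<and> (if 0 < done v \<or> v = u then d' v = d v else d u \<le> d' v)) \<and>
     (\<forall>e<j. tv e = u \<longrightarrow> d' (hv e) \<le> d u + wt e)"

lemma relaxed_labels_0:
  assumes "settled_labels n m tv hv wt \<pi> done d" "\<And>v. v < n \<Longrightarrow> done v = 0 \<Longrightarrow> d u \<le> d v"
  shows "relaxed_labels n tv hv wt \<pi> done d u 0 d"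
  using assms by (auto simp: relaxed_labels_def settled_labels_def)

text \<open>Settled labels are at most \<open>d u\<close>, so with a positive weight no relaxation
  from \<open>u\<close> can improve them or \<open>u\<close> itself. Feasibility of
  \<open>\<pi>\<close> carries the lower bound over to the new label.\<close>

lemma relaxed_labels_Suc:
  assumes "relaxed_labels n tv hv wt \<pi> done d u j d'" "settled_labels n m tv hv wt \<pi> done d"
    and "u < n" "done u = 0" "hv j < n" "0 < wt j" "\<pi> (hv j) \<le> \<pi> (tv j) + wt j"
  shows "relaxed_labels n tv hv wt \<pi> done d u (Suc j)
    (if tv j = u \<and> d' u + wt j < d' (hv j) then d'(hv j := d' u + wt j) else d')"
proof (cases "tv j = u \<and> d' u + wt j < d' (hv j)")
  case True
  have u: "d' u = d u" "\<pi> u \<le> d' u" using assms(1,3) by (auto simp: relaxed_labels_def)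
  have "\<not> (0 < done (hv j) \<or> hv j = u)"
  proof
    assume "0 < done (hv j) \<or> hv j = u"
    then have "d' (hv j) = d (hv j)" "d (hv j) \<le> d u"
      using assms(1-5) unfolding relaxed_labels_def settled_labels_def by auto
    then show False using True u assms(6) by simp
  qed
  then have new: "done (hv j) = 0" "hv j \<noteq> u" by auto
  have old: "\<pi> v \<le> d' v \<and> d' v \<le> d v \<and> (if 0 < done v \<or> v = u then d' v = d v else d u \<le> d' v)" if "v < n" for v
    using assms(1) that by (simp add: relaxed_labels_def)
  have arcs: "d' (hv e) \<le> d u + wt e" if "e < j" "tv e = u" for e
    using assms(1) that by (simp add: relaxed_labels_def)
  let ?d = "d'(hv j := d u + wt j)"
  have "\<pi> v \<le> ?d v \<and> ?d v \<le> d v \<and> (if 0 < done v \<or> v = u then ?d v = d v else d u \<le> ?d v)"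
    if "v < n" for v
    using old[OF that] new True u assms(6,7) by (cases "v = hv j") auto
  moreover have "?d (hv e) \<le> d u + wt e" if "e < Suc j" "tv e = u" for e
    using arcs[of e] that True u by (cases "e = j") (auto simp: less_Suc_eq)
  ultimately have "relaxed_labels n tv hv wt \<pi> done d u (Suc j) ?d"
    unfolding relaxed_labels_def by blast
  then show ?thesis using True u by simp
next
  case False
  have "d' u = d u" using assms(1,3) by (auto simp: relaxed_labels_def)
  then show ?thesis using False assms(1) by (auto simp: relaxed_labels_def less_Suc_eq)
qed

text \<open>Labels of settled tails are frozen while labels of heads only fall, so earlier
  inequalities survive; the arcs out of \<open>u\<close> have all been relaxed. Unsettled labels
  remain at least \<open>d u\<close>, which dominates every settled one.\<close>

lemma settled_labels_settle:
  assumes "relaxed_labels n tv hv wt \<pi> done d u m d'" "settled_labels n m tv hv wt \<pi> done d"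
    and "u < n" "done u = 0" "\<And>e. e < m \<Longrightarrow> tv e < n \<and> hv e < n"
  shows "settled_labels n m tv hv wt \<pi> (done(u := Suc 0)) d'"
proof -
  have d': "\<pi> v \<le> d' v" "d' v \<le> d v" "0 < done v \<or> v = u \<Longrightarrow> d' v = d v"
    "\<not> (0 < done v \<or> v = u) \<Longrightarrow> d u \<le> d' v" if "v < n" for v
    using assms(1) that by (auto simp: relaxed_labels_def split: if_splits)
  have r: "d' (hv e) \<le> d u + wt e" if "e < m" "tv e = u" for e
    using assms(1) that by (auto simp: relaxed_labels_def)
  have a: "d (hv e) \<le> d (tv e) + wt e" if "e < m" "0 < done (tv e)" for e
    using assms(2) that by (auto simp: settled_labels_def)
  have b: "d x \<le> d u" if "x < n" "0 < done x" for x
    using assms(2-4) that by (auto simp: settled_labels_def)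
  show ?thesis unfolding settled_labels_def
  proof (intro conjI allI impI)
    fix e assume e: "e < m" "0 < (done(u := Suc 0)) (tv e)"
    show "d' (hv e) \<le> d' (tv e) + wt e"
    proof (cases "tv e = u")
      case True
      then show ?thesis using r[OF e(1)] d'(3)[OF assms(3)] by simp
    next
      case False
      then have "0 < done (tv e)" using e by simp
      then show ?thesis using a[OF e(1)] d'(3)[of "tv e"] d'(2)[of "hv e"] assms(5)[OF e(1)] by force
    qed
  next
    fix x v assume "x < n" "v < n" "0 < (done(u := Suc 0)) x" "(done(u := Suc 0)) v = 0"
    then show "d' x \<le> d' v"
      using d'(3)[of x] b[of x] d'(4)[of v] by (cases "x = u"; cases "v = u") auto
  qed (use d'(1) in auto)
qed

text \<open>The vertex \<open>s\<close> is just a valid index to start from: a settled candidate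
  gives way to any unsettled vertex, an unsettled one only to a strictly smaller label.\<close>

definition closest :: com where
  "closest = Seq (NSet ''u'' (NConst 0) (Var ''s''))
    (For ''i'' (Var ''n'')
      (Cond (BAnd (Zero (NGet ''done'' (Var ''i''))) (BNot (BAnd (Zero (NGet ''done'' (Var ''u'')))
          (BNot (RLess (RGet ''dist'' (Var ''i'')) (RGet ''dist'' (Var ''u'')))))))
        (NSet ''u'' (NConst 0) (Var ''i'')) Skip))"

definition relax :: com where
  "relax = Seq (NSet ''done'' (Var ''u'') (NConst 1))
    (For ''i'' (Var ''m'')
      (let a = NGet ''tail'' (Var ''i''); b = NGet ''head'' (Var ''i'');
        c = RAdd (RGet ''dist'' (Var ''u'')) (RGet ''weight'' (Var ''i''))
       in Cond (BAnd (BAnd (BNot (NLess a (Var ''u''))) (BNot (NLess (Var ''u'') a))) (RLess c (RGet ''dist'' b)))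
        (RSet ''dist'' b c) Skip))"

definition dijkstra :: com where
  "dijkstra =
     Seq (For ''i'' (Var ''n'') (Seq (NSet ''done'' (Var ''i'') (NConst 0))
        (RSet ''dist'' (Var ''i'') (RGet ''total'' (NConst 0)))))
    (Seq (RSet ''dist'' (Var ''s'') (RSub (RGet ''dist'' (Var ''s'')) (RGet ''dist'' (Var ''s''))))
     (For ''r'' (Var ''n'') (Seq closest (Cond (Zero (NGet ''done'' (Var ''u''))) relax Skip))))"

lemma writes_closest: "writes closest = {''u'', ''i''}"
  by (auto simp: closest_def)

lemma writes_relax: "writes relax = {''done'', ''i'', ''dist''}"
  by (auto simp: relax_def Let_def)

lemma writes_dijkstra: "writes dijkstra = {''i'', ''done'', ''dist'', ''r'', ''u''}"
  by (auto simp: dijkstra_def writes_closest writes_relax)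

lemma runs_closest:
  assumes mem: "nmem \<sigma> ''n'' 0 = n" "nmem \<sigma> ''s'' 0 = s" and s: "s < n"
  shows "runs closest \<sigma> (1 + (2 + n * (3 + 2))) (\<lambda>\<tau>. nmem \<tau> ''u'' 0 < n \<and> (\<forall>v<n. nmem \<sigma> ''done'' v = 0 \<longrightarrow>
    nmem \<sigma> ''done'' (nmem \<tau> ''u'' 0) = 0 \<and> rmem \<sigma> ''dist'' (nmem \<tau> ''u'' 0) \<le> rmem \<sigma> ''dist'' v))"
  unfolding closest_def
proof (rule runs_Seq[where R = "\<lambda>\<tau>. \<tau> = nset ''u'' 0 s \<sigma>"], goal_cases)
  case 1
  show ?case by (rule runs_NSet) (simp add: mem)
next
  case (2 \<tau>)
  show ?case unfolding 2(1)
  proof (rule runs_For[where I = "\<lambda>j \<tau>. nmem \<tau> ''u'' 0 < n \<and> (\<forall>v<j. nmem \<sigma> ''done'' v = 0 \<longrightarrow>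
    nmem \<sigma> ''done'' (nmem \<tau> ''u'' 0) = 0 \<and> rmem \<sigma> ''dist'' (nmem \<tau> ''u'' 0) \<le> rmem \<sigma> ''dist'' v)"], goal_cases)
    case 1
    show ?case using s by simp
  next
    case (2 \<upsilon>)
    show ?case using agree_nmem[OF 2] mem by simp
  next
    case (4 j \<upsilon>)
    have "nmem \<upsilon> ''done'' = nmem \<sigma> ''done''" "rmem \<upsilon> ''dist'' = rmem \<sigma> ''dist''"
      using agree_nmem[OF 4(2)] agree_rmem[OF 4(2)] by simp_all
    then show ?case using 4(1,3,4)
      by (intro runs_loop_free) (force simp: less_Suc_eq)+
  qed auto
qed

lemma runs_relax:
  assumes mem: "nmem \<sigma> ''m'' 0 = m" "nmem \<sigma> ''tail'' = tv" "nmem \<sigma> ''head'' = hv" "rmem \<sigma> ''weight'' = wt"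
    "nmem \<sigma> ''u'' 0 = u"
    and labels: "settled_labels n m tv hv wt \<pi> (nmem \<sigma> ''done'') (rmem \<sigma> ''dist'')"
    and u: "u < n" "nmem \<sigma> ''done'' u = 0"
    and min: "\<And>v. v < n \<Longrightarrow> nmem \<sigma> ''done'' v = 0 \<Longrightarrow> rmem \<sigma> ''dist'' u \<le> rmem \<sigma> ''dist'' v"
    and arcs: "\<And>e. e < m \<Longrightarrow> tv e < n \<and> hv e < n \<and> 0 < wt e \<and> \<pi> (hv e) \<le> \<pi> (tv e) + wt e"
  shows "runs relax \<sigma> (1 + (2 + m * (3 + 2))) (\<lambda>\<tau>.
    settled_labels n m tv hv wt \<pi> (nmem \<tau> ''done'') (rmem \<tau> ''dist'') \<and>
    nmem \<tau> ''done'' = (nmem \<sigma> ''done'')(u := 1) \<and> (\<forall>v<n. rmem \<tau> ''dist'' v \<le> rmem \<sigma> ''dist'' v))"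
  unfolding relax_def
proof (rule runs_Seq[where R = "\<lambda>\<tau>. \<tau> = nset ''done'' u 1 \<sigma>"], goal_cases)
  case 1
  show ?case by (rule runs_NSet) (simp add: mem)
next
  case (2 \<tau>)
  let ?R = "relaxed_labels n tv hv wt \<pi> (nmem \<sigma> ''done'') (rmem \<sigma> ''dist'') u"
  show ?case unfolding 2(1)
  proof (rule runs_For[where I = "\<lambda>j \<tau>. ?R j (rmem \<tau> ''dist'')"], goal_cases)
    case 1
    show ?case using relaxed_labels_0[OF labels min] by simp
  next
    case (2 \<upsilon>)
    show ?case using agree_nmem[OF 2] mem by (simp add: Let_def)
  next
    case (4 j \<upsilon>)
    have fr: "nmem \<upsilon> ''tail'' = tv" "nmem \<upsilon> ''head'' = hv" "rmem \<upsilon> ''weight'' = wt" "nmem \<upsilon> ''u'' 0 = u"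
      using agree_nmem[OF 4(2)] agree_rmem[OF 4(2)] mem by (simp_all add: Let_def)
    have "?R (Suc j) (if tv j = u \<and> rmem \<upsilon> ''dist'' u + wt j < rmem \<upsilon> ''dist'' (hv j)
        then (rmem \<upsilon> ''dist'')(hv j := rmem \<upsilon> ''dist'' u + wt j) else rmem \<upsilon> ''dist'')" (is "?R _ ?d")
      using arcs[OF 4(4)] by (intro relaxed_labels_Suc[OF 4(1) labels u]) auto
    moreover have "(\<not> tv j < u \<and> \<not> u < tv j) = (tv j = u)" by auto
    ultimately show ?case using 4(3) fr
      by (intro runs_loop_free) (auto simp: Let_def split: if_splits)
  next
    case (5 \<upsilon>)
    have d: "nmem \<upsilon> ''done'' = (nmem \<sigma> ''done'')(u := 1)"
      using agree_nmem[OF 5(2)] by (simp add: Let_def)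
    show ?case using settled_labels_settle[OF 5(1) labels u] arcs 5(1) unfolding d
      by (auto simp: relaxed_labels_def)
  qed (auto simp: Let_def)
qed

definition dijkstra_cost :: "nat \<Rightarrow> nat \<Rightarrow> nat" where
  "dijkstra_cost n m = (2 + n * (2 + 2)) + (1 +
     (2 + n * (((1 + (2 + n * (3 + 2))) + Suc (1 + (2 + m * (3 + 2)))) + 2)))"

lemma runs_dijkstra:
  assumes mem: "nmem \<sigma> ''n'' 0 = n" "nmem \<sigma> ''m'' 0 = m" "nmem \<sigma> ''s'' 0 = s"
    "nmem \<sigma> ''tail'' = tv" "nmem \<sigma> ''head'' = hv" "rmem \<sigma> ''weight'' = wt" "rmem \<sigma> ''total'' 0 = L"
    and s: "s < n" "\<pi> s \<le> 0" "0 \<le> L"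
    and arcs: "\<And>e. e < m \<Longrightarrow> tv e < n \<and> hv e < n \<and> 0 < wt e \<and> \<pi> (hv e) \<le> \<pi> (tv e) + wt e"
    and le: "\<And>v. v < n \<Longrightarrow> \<pi> v \<le> L"
  shows "runs dijkstra \<sigma> (dijkstra_cost n m) (\<lambda>\<tau>. rmem \<tau> ''dist'' s \<le> 0 \<and>
    (\<forall>v<n. \<pi> v \<le> rmem \<tau> ''dist'' v) \<and>
    (\<forall>e<m. rmem \<tau> ''dist'' (hv e) \<le> rmem \<tau> ''dist'' (tv e) + wt e))"
  (is "runs _ _ _ ?Q")
  unfolding dijkstra_def dijkstra_cost_def
proof (rule runs_Seq[where R = "\<lambda>\<tau>. \<forall>v<n. nmem \<tau> ''done'' v = 0 \<and> rmem \<tau> ''dist'' v = L"],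
    rule runs_For[where N = n and I = "\<lambda>j \<tau>. \<forall>v<j. nmem \<tau> ''done'' v = 0 \<and> rmem \<tau> ''dist'' v = L"], goal_cases)
  case (2 \<tau>)
  show ?case using agree_nmem[OF 2] mem by simp
next
  case (4 j \<tau>)
  have "rmem \<tau> ''total'' 0 = L" using agree_rmem[OF 4(2)] mem by simp
  then show ?case using 4(1,3) by (intro runs_loop_free) (auto simp: less_Suc_eq)
next
  case (6 \<tau>)
  let ?\<phi> = "rset ''dist'' s 0 \<tau>"
  let ?W = "{''i'', ''done'', ''dist'', ''r'', ''u''}"
  have a: "agree {''i'', ''done'', ''dist''} \<sigma> \<tau>" using 6(2) by (simp add: insert_commute)
  have fr: "nmem \<tau> ''n'' 0 = n" "nmem \<tau> ''m'' 0 = m" "nmem \<tau> ''s'' 0 = s" "nmem \<tau> ''tail'' = tv"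
    "nmem \<tau> ''head'' = hv" "rmem \<tau> ''weight'' = wt"
    using mem agree_nmem[OF a] agree_rmem[OF a] by simp_all
  \<comment> \<open>After \<open>n\<close> rounds the count forces all vertices to be settled, and
    the first clause of \<open>settled_labels\<close> becomes feasibility on every arc.\<close>
  let ?I = "\<lambda>j \<tau>. settled_labels n m tv hv wt \<pi> (nmem \<tau> ''done'') (rmem \<tau> ''dist'') \<and>
    rmem \<tau> ''dist'' s \<le> 0 \<and> j \<le> card {v. v < n \<and> 0 < nmem \<tau> ''done'' v}"
  let ?c = "Seq closest (Cond (Zero (NGet ''done'' (Var ''u''))) relax Skip)"
  have wc: "insert ''r'' (writes ?c) = {''r'', ''u'', ''i'', ''done'', ''dist''}"
    by (auto simp: writes_closest writes_relax)
  have "runs (For ''r'' (Var ''n'') ?c) ?\<phi>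
    (2 + n * (((1 + (2 + n * (3 + 2))) + Suc (1 + (2 + m * (3 + 2)))) + 2)) ?Q"
  proof (rule runs_For[where I = ?I], goal_cases)
    case 1
    have "settled_labels n m tv hv wt \<pi> (nmem \<tau> ''done'') ((rmem \<tau> ''dist'')(s := 0))"
      using 6(1) s le arcs by (auto simp: settled_labels_def)
    then show ?case by simp
  next
    case (2 \<upsilon>)
    show ?case using agree_nmem[OF 2] fr by (simp add: writes_closest writes_relax)
  next
    case 3
    show ?case by (simp add: writes_closest writes_relax)
  next
    case (4 j \<upsilon>)
    have a: "agree {''r'', ''u'', ''i'', ''done'', ''dist''} ?\<phi> \<upsilon>" using 4(2) unfolding wc .
    have fr: "nmem \<upsilon> ''n'' 0 = n" "nmem \<upsilon> ''m'' 0 = m" "nmem \<upsilon> ''s'' 0 = s" "nmem \<upsilon> ''tail'' = tv"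
      "nmem \<upsilon> ''head'' = hv" "rmem \<upsilon> ''weight'' = wt"
      using fr agree_nmem[OF a] agree_rmem[OF a] by simp_all
    show ?case
    proof (rule runs_Seq[OF runs_closest[OF fr(1,3) s(1)]], rule runs_Cond, goal_cases)
      case (1 \<omega>)
      let ?u = "nmem \<omega> ''u'' 0"
      have fw: "nmem \<omega> ''done'' = nmem \<upsilon> ''done''" "rmem \<omega> ''dist'' = rmem \<upsilon> ''dist''"
        "nmem \<omega> ''m'' 0 = m" "nmem \<omega> ''tail'' = tv" "nmem \<omega> ''head'' = hv" "rmem \<omega> ''weight'' = wt"
        using agree_nmem[OF 1(2)] agree_rmem[OF 1(2)] fr by (simp_all add: writes_closest)
      have u: "?u < n" "nmem \<omega> ''done'' ?u = 0" using 1(1,3) by simp_all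
      show ?case
      proof (rule runs_mono[OF runs_relax[OF fw(3-6) refl _ u, where \<pi> = \<pi>]], goal_cases)
        case (5 \<psi>)
        have "{v. v < n \<and> 0 < nmem \<psi> ''done'' v} = insert ?u {v. v < n \<and> 0 < nmem \<upsilon> ''done'' v}"
          using 5(1) u fw by auto
        then have "Suc j \<le> card {v. v < n \<and> 0 < nmem \<psi> ''done'' v}"
          using 4(1) u fw by simp
        moreover have "rmem \<psi> ''dist'' s \<le> rmem \<upsilon> ''dist'' s" using 5(1) s(1) fw by simp
        ultimately show ?case using 5(1) 4(1) by auto
      qed (use 1 4 fw arcs in auto)
    next
      case (2 \<omega>)
      have fw: "nmem \<omega> ''done'' = nmem \<upsilon> ''done''" "rmem \<omega> ''dist'' = rmem \<upsilon> ''dist''"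
        using agree_nmem[OF 2(2)] agree_rmem[OF 2(2)] by (simp_all add: writes_closest)
      have "\<forall>v<n. 0 < nmem \<upsilon> ''done'' v" using 2(1,3) fw by auto
      then have "{v. v < n \<and> 0 < nmem \<upsilon> ''done'' v} = {..<n}" by auto
      then have "Suc j \<le> card {v. v < n \<and> 0 < nmem \<omega> ''done'' v}" using 4(4) fw by simp
      then show ?case using 4(1) fw by (intro runs_loop_free) auto
    qed
  next
    case (5 \<upsilon>)
    have "card {v. v < n \<and> 0 < nmem \<upsilon> ''done'' v} = card {..<n}"
      using 5(1) card_mono[of "{..<n}" "{v. v < n \<and> 0 < nmem \<upsilon> ''done'' v}"] by fastforce
    then have "{v. v < n \<and> 0 < nmem \<upsilon> ''done'' v} = {..<n}"
      by (intro card_subset_eq) auto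
    then have "0 < nmem \<upsilon> ''done'' v" if "v < n" for v using that by blast
    then show ?case using 5(1) arcs by (auto simp: settled_labels_def)
  qed
  then show ?case
    using fr by (intro runs_Seq[where R = "\<lambda>\<tau>'. \<tau>' = ?\<phi>"] runs_loop_free[of "RSet _ _ _"]) auto
qed auto

text \<open>
  Vertices keep their numbers below \<open>n\<close>, the source is \<open>n\<close> and the sink is \<open>n + 1\<close>. Arcs of \<open>P\<close> and
  arcs that are not tight become loops at the source, which lie in no cut.
\<close>

definition contract :: com where
  "contract = For ''i'' (Var ''m'')
    (let a = NGet ''tail'' (Var ''i''); b = NGet ''head'' (Var ''i'')
     in Cond (BAnd (Zero (NGet ''in_path'' (Var ''i'')))
          (BNot (RLess (RGet ''dist'' b) (RAdd (RGet ''dist'' a) (RGet ''weight'' (Var ''i''))))))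
        (Seq (Cond (Pos (NGet ''on_path'' a)) (NSet ''src'' (Var ''i'') (Var ''n'')) (NSet ''src'' (Var ''i'') a))
          (Cond (Pos (NGet ''on_path'' b)) (NSet ''dst'' (Var ''i'') (NAdd (Var ''n'') (NConst 1)))
             (NSet ''dst'' (Var ''i'') b)))
        (Seq (NSet ''src'' (Var ''i'') (Var ''n'')) (NSet ''dst'' (Var ''i'') (Var ''n''))))"

text \<open>For a feasible potential the inequality \<open>d (tv e) + wt e \<le> d (hv e)\<close>
  already is tightness, so one comparison decides it.\<close>

lemma runs_contract:
  assumes mem: "nmem \<sigma> ''n'' 0 = n" "nmem \<sigma> ''m'' 0 = m" "nmem \<sigma> ''tail'' = tv" "nmem \<sigma> ''head'' = hv"
    "rmem \<sigma> ''weight'' = wt" "nmem \<sigma> ''on_path'' = on" "nmem \<sigma> ''in_path'' = on_arc" "rmem \<sigma> ''dist'' = d"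
  shows "runs contract \<sigma> (2 + m * (9 + 2)) (\<lambda>\<tau>. \<forall>e<m.
    if on_arc e = 0 \<and> d (tv e) + wt e \<le> d (hv e)
    then nmem \<tau> ''src'' e = (if 0 < on (tv e) then n else tv e) \<and>
      nmem \<tau> ''dst'' e = (if 0 < on (hv e) then n + 1 else hv e)
    else nmem \<tau> ''src'' e = n \<and> nmem \<tau> ''dst'' e = n)" (is "runs _ _ _ (?Q m)")
  unfolding contract_def
proof (rule runs_For[where I = ?Q], goal_cases)
  case (2 \<tau>)
  show ?case using agree_nmem[OF 2] mem by (simp add: Let_def)
next
  case (4 j \<tau>)
  have "nmem \<tau> ''n'' 0 = n" "nmem \<tau> ''tail'' = tv" "nmem \<tau> ''head'' = hv" "rmem \<tau> ''weight'' = wt"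
    "nmem \<tau> ''on_path'' = on" "nmem \<tau> ''in_path'' = on_arc" "rmem \<tau> ''dist'' = d"
    using agree_nmem[OF 4(2)] agree_rmem[OF 4(2)] mem by (simp_all add: Let_def)
  then show ?case using 4(1,3)
    by (intro runs_loop_free) (auto simp: Let_def less_Suc_eq not_less)
qed (auto simp: Let_def)

section \<open>Anti-forcing sets as cuts\<close>

context wf_digraph
begin

lemma potential_le_cost:
  assumes "\<And>e. e \<in> arcs G \<Longrightarrow> d (head G e) \<le> d (tail G e) + w e" "awalk u p v"
  shows "d v \<le> d u + awalk_cost w p"
  using assms(2)
proof (induction p arbitrary: u)
  case (Cons e p)
  then show ?case using assms(1)[of e] by (fastforce simp: awalk_Cons_iff)
qed (simp add: awalk_Nil_iff)

lemma tight_cost: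
  assumes "awalk u p v" "\<And>e. e \<in> set p \<Longrightarrow> d (head G e) = d (tail G e) + w e"
  shows "d v = d u + awalk_cost w p"
  using assms
proof (induction p arbitrary: u)
  case (Cons e p)
  then have "d v = d (head G e) + awalk_cost w p" "d (head G e) = d u + w e"
    by (auto simp: awalk_Cons_iff)
  then show ?case by simp
qed (simp add: awalk_Nil_iff)

text \<open>Complementary slackness: the slacks along \<open>p\<close> are nonnegative and their sum
  is at most zero, so each of them vanishes.\<close>

lemma cost_tight:
  assumes feasible: "\<And>e. e \<in> arcs G \<Longrightarrow> d (head G e) \<le> d (tail G e) + w e"
    and "awalk u p v" "d u + awalk_cost w p \<le> d v" "e \<in> set p"
  shows "d (head G e) = d (tail G e) + w e"
  using assms(2-)
proof (induction p arbitrary: u)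
  case (Cons a p)
  have a: "a \<in> arcs G" "tail G a = u" "awalk (head G a) p v" using Cons.prems by (auto simp: awalk_Cons_iff)
  have "d v \<le> d (head G a) + awalk_cost w p" using potential_le_cost[OF feasible a(3)] .
  then have "d (head G a) = d u + w a" using feasible[OF a(1)] Cons.prems(2) a(2) by simp
  then show ?case using Cons.IH[OF a(3)] Cons.prems a by auto
qed simp

text \<open>With positive weights \<open>d\<close> increases strictly along tight arcs. The bound on
  all visited vertices strengthens the induction: it keeps \<open>u\<close> off the rest of the
  walk.\<close>

lemma tight_apath:
  fixes w :: "'b \<Rightarrow> real"
  assumes "\<And>e. e \<in> arcs G \<Longrightarrow> 0 < w e" "awalk u p v"
    and "\<And>e. e \<in> set p \<Longrightarrow> d (head G e) = d (tail G e) + w e"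
  shows "apath u p v \<and> (\<forall>x\<in>set (awalk_verts u p). d u \<le> d x)"
  using assms(2,3)
proof (induction p arbitrary: u)
  case (Cons e p)
  then have e: "e \<in> arcs G" "tail G e = u" "awalk (head G e) p v" by (auto simp: awalk_Cons_iff)
  have IH: "apath (head G e) p v" "\<forall>x\<in>set (awalk_verts (head G e) p). d (head G e) \<le> d x"
    using Cons.IH[OF e(3)] Cons.prems(2) by auto
  moreover have "d u < d (head G e)" using Cons.prems(2)[of e] assms(1)[OF e(1)] e(2) by simp
  ultimately show ?case using e by (force simp: apath_Cons_iff)
qed (simp add: awalk_Nil_iff apath_Nil_iff)

text \<open>A path has only one arc starting at \<open>u\<close>, so the first arcs coincide. That
  arc cannot occur again later, and hence the inclusion passes to the remaining paths.\<close>

lemma apath_eqI_subset: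
  assumes "apath u p v" "apath u q v" "set q \<subseteq> set p"
  shows "q = p"
  using assms
proof (induction p arbitrary: u q)
  case (Cons e p)
  have "u \<noteq> v" using apath_nonempty_ends[OF Cons.prems(1)] by simp
  then obtain a r where q: "q = a # r" using Cons.prems(2) by (cases q) (auto simp: apath_Nil_iff)
  have notin: "x \<notin> set p'" if "apath (head G e') p' v" "u \<notin> set (awalk_verts (head G e') p')" "tail G x = u" for e' p' x
    using that set_awalk_verts[of "head G e'" p' v] by (auto simp: apath_def)
  have e: "tail G e = u" "apath (head G e) p v" "u \<notin> set (awalk_verts (head G e) p)"
    using Cons.prems(1) by (auto simp: apath_Cons_iff)
  have a: "tail G a = u" "apath (head G a) r v" "u \<notin> set (awalk_verts (head G a) r)"
    using Cons.prems(2) q by (auto simp: apath_Cons_iff)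
  have "a = e" using Cons.prems(3) q notin[OF e(2,3) a(1)] by auto
  moreover have "e \<notin> set r" using notin[OF a(2,3) e(1)] .
  ultimately show ?case using Cons q a e by auto
qed auto

text \<open>Shortest paths compete only with paths by definition. In the absence of negative cycles
  a walk reduces to a path of no greater cost.\<close>

lemma shortest_path_awalk_cost_le:
  assumes "shortest_path w s P t" "\<And>e. e \<in> arcs G \<Longrightarrow> 0 \<le> w e" "awalk s p t"
  shows "awalk_cost w P \<le> awalk_cost w p"
proof -
  have "\<not> (\<exists>x c. awalk x c x \<and> x \<in> set (awalk_verts s p) \<and> awalk_cost w c < 0)"
    using pos_cost_pos_awalk_cost[of _ _ _ w] assms(2) by (meson not_le)
  then have "awalk_cost w (awalk_to_apath p) \<le> awalk_cost w p"
    using awalk_to_path_no_neg_cyc_cost assms(3) by blast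
  then show ?thesis
    using apath_awalk_to_apath[OF assms(3)] assms(1) unfolding shortest_path_def by force
qed

text \<open>The witness is the distance from \<open>s\<close>, cut off at the length of the shortest path.\<close>

lemma shortest_path_potential:
  assumes sp: "shortest_path w s P t" and nonneg: "\<And>e. e \<in> arcs G \<Longrightarrow> 0 \<le> w e"
  obtains \<pi> :: "'a \<Rightarrow> real" where "\<And>e. e \<in> arcs G \<Longrightarrow> \<pi> (head G e) \<le> \<pi> (tail G e) + w e"
    "\<pi> s = 0" "\<pi> t = awalk_cost w P" "\<And>v. \<pi> v \<le> awalk_cost w P"
proof
  let ?L = "awalk_cost w P"
  \<comment> \<open>The inserted element is the cap; it also keeps the set nonempty for vertices
    unreachable from \<open>s\<close>.\<close>
  let ?D = "\<lambda>v. insert ?L {awalk_cost w p | p. awalk s p v}"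
  define \<pi> where "\<pi> = (\<lambda>v. Inf (?D v))"
  have P: "awalk s P t" using sp by (simp add: shortest_path_def apath_def)
  have ge: "0 \<le> x" if "x \<in> ?D v" for x v
    using that pos_cost_pos_awalk_cost[of _ _ _ w] nonneg P by auto
  have bdd: "bdd_below (?D v)" for v using ge by (rule bdd_belowI)
  show le: "\<pi> v \<le> ?L" for v unfolding \<pi>_def using bdd by (intro cInf_lower) auto
  show "\<pi> (head G e) \<le> \<pi> (tail G e) + w e" if e: "e \<in> arcs G" for e
  proof -
    have "\<pi> (head G e) - w e \<le> \<pi> (tail G e)"
      unfolding \<pi>_def[THEN fun_cong, of "tail G e"]
    proof (rule cInf_greatest)
      fix x assume "x \<in> ?D (tail G e)"
      then consider "x = ?L" | p where "awalk s p (tail G e)" "x = awalk_cost w p" by auto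
      then show "\<pi> (head G e) - w e \<le> x"
      proof cases
        case 1
        then show ?thesis using le[of "head G e"] nonneg[OF e] by simp
      next
        case (2 p)
        then have "awalk s (p @ [e]) (head G e)" using arc_implies_awalk[OF e] by (rule_tac awalk_appendI)
        then have "\<pi> (head G e) \<le> awalk_cost w (p @ [e])"
          unfolding \<pi>_def using bdd by (intro cInf_lower) blast+
        then show ?thesis using 2 by simp
      qed
    qed simp
    then show ?thesis by simp
  qed
  show "\<pi> s = 0"
  proof (rule antisym)
    have "awalk s [] s" using P by (auto simp: awalk_Nil_iff)
    then show "\<pi> s \<le> 0" unfolding \<pi>_def using bdd
      by (intro cInf_lower) (auto intro!: exI[of _ "[]"])
    show "0 \<le> \<pi> s" unfolding \<pi>_def using ge by (intro cInf_greatest) blast+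
  qed
  show "\<pi> t = ?L"
  proof (rule antisym[OF le])
    show "?L \<le> \<pi> t" unfolding \<pi>_def
      using shortest_path_awalk_cost_le[OF sp nonneg] by (intro cInf_greatest) auto
  qed
qed

end

section \<open>Detours and their cuts\<close>

locale tight_potential = wf_digraph +
  fixes w :: "'b \<Rightarrow> real" and s t :: 'a and P :: "'b list" and d :: "'a \<Rightarrow> real"
  assumes pos: "e \<in> arcs G \<Longrightarrow> 0 < w e"
    and P: "shortest_path w s P t"
    and feasible: "e \<in> arcs G \<Longrightarrow> d (head G e) \<le> d (tail G e) + w e"
    and ends: "d t = d s + awalk_cost w P"
begin

definition detour_arcs :: "'b set" where
  "detour_arcs = {e \<in> arcs G. d (head G e) = d (tail G e) + w e \<and> e \<notin> set P}"

text \<open>A cut of the contracted graph read in the original one. A vertex of \<open>P\<close>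
  counts as source when it is a tail and, with \<open>Y\<close> chosen disjoint from
  \<open>P\<close>, as sink when it is a head.\<close>

definition detour_cut :: "'a set \<Rightarrow> 'b set" where
  "detour_cut Y = {e \<in> detour_arcs. tail G e \<in> set (awalk_verts s P) \<union> Y \<and> head G e \<notin> Y}"

lemma awalk_P: "awalk s P t"
  using P by (simp add: shortest_path_def apath_def)

lemma tight_P: "e \<in> set P \<Longrightarrow> d (head G e) = d (tail G e) + w e"
  using cost_tight[OF feasible awalk_P] ends by simp

lemma shortest_path_tight:
  assumes "shortest_path w s Q t" "e \<in> set Q"
  shows "d (head G e) = d (tail G e) + w e"
proof -
  have "awalk s Q t" "awalk_cost w Q \<le> awalk_cost w P"
    using assms(1) P by (auto simp: shortest_path_def apath_def)
  then show ?thesis using cost_tight[OF feasible, of s Q t e] ends assms(2) by simp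
qed

text \<open>Tightness fixes the cost through the potential difference and makes the walk a path, so
  neither has to be checked for spliced walks.\<close>

lemma shortest_path_if_tight:
  assumes "awalk s Q t" "\<And>e. e \<in> set Q \<Longrightarrow> d (head G e) = d (tail G e) + w e"
  shows "shortest_path w s Q t"
proof -
  have "awalk_cost w Q = awalk_cost w P" using tight_cost[OF assms] ends by simp
  then show ?thesis using tight_apath[OF pos assms] P by (simp add: shortest_path_def)
qed

lemma awalk_verts_P: "e \<in> set P \<Longrightarrow> tail G e \<in> set (awalk_verts s P) \<and> head G e \<in> set (awalk_verts s P)"
  using set_awalk_verts[OF awalk_P] by auto

text \<open>Once a tight walk that avoids the cut has left \<open>P\<close>, it stays inside \<open>Y\<close>.\<close>

lemma avoids_detour_cut_stays:
  assumes "awalk v q x" "v \<in> Y" "Y \<inter> set (awalk_verts s P) = {}" "set q \<inter> detour_cut Y = {}"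
    and "\<And>e. e \<in> set q \<Longrightarrow> d (head G e) = d (tail G e) + w e"
  shows "x \<in> Y"
  using assms(1,2,4,5)
proof (induction q arbitrary: v)
  case (Cons e q)
  then have e: "e \<in> arcs G" "tail G e = v" "awalk (head G e) q x" by (auto simp: awalk_Cons_iff)
  have "e \<notin> set P" using Cons.prems(2) e(2) assms(3) awalk_verts_P by blast
  then have "head G e \<in> Y"
    using Cons.prems e by (auto simp: detour_cut_def detour_arcs_def)
  then show ?case using Cons.IH[OF e(3)] Cons.prems by auto
qed (simp add: awalk_Nil_iff)

text \<open>The first arc outside \<open>P\<close> would enter \<open>Y\<close>, and from there the
  walk could not get back to \<open>x\<close>.\<close>

lemma avoids_detour_cut_subset:
  assumes "awalk v q x" "v \<in> set (awalk_verts s P)" "x \<in> set (awalk_verts s P)"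
    and Y: "Y \<inter> set (awalk_verts s P) = {}" and "set q \<inter> detour_cut Y = {}"
    and "\<And>e. e \<in> set q \<Longrightarrow> d (head G e) = d (tail G e) + w e"
  shows "set q \<subseteq> set P"
  using assms(1,2,5,6)
proof (induction q arbitrary: v)
  case (Cons e q)
  then have e: "e \<in> arcs G" "tail G e = v" "awalk (head G e) q x" by (auto simp: awalk_Cons_iff)
  have "e \<in> set P"
  proof (rule ccontr)
    assume "e \<notin> set P"
    then have "head G e \<in> Y"
      using Cons.prems e by (auto simp: detour_cut_def detour_arcs_def)
    then have "x \<in> Y" using avoids_detour_cut_stays[OF e(3) _ Y] Cons.prems(3,4) by simp
    then show False using assms(3) Y by blast
  qed
  then show ?case using Cons.IH[OF e(3)] Cons.prems awalk_verts_P by simp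
qed simp

lemma anti_forcing_set_detour_cut:
  assumes "Y \<inter> set (awalk_verts s P) = {}"
  shows "anti_forcing_set w s t P (detour_cut Y)"
  unfolding anti_forcing_set_def
proof (intro conjI allI impI)
  fix Q assume Q: "shortest_path w s Q t \<and> Q \<noteq> P"
  have verts: "s \<in> set (awalk_verts s P)" "t \<in> set (awalk_verts s P)"
    using awalk_P hd_in_set[OF awalk_verts_non_Nil[of s P]] last_in_set[OF awalk_verts_non_Nil[of s P]] by auto
  show "detour_cut Y \<inter> set Q \<noteq> {}"
  proof
    assume "detour_cut Y \<inter> set Q = {}"
    then have "set Q \<subseteq> set P"
      using Q verts assms shortest_path_tight[of Q]
      by (intro avoids_detour_cut_subset[of s Q t Y]) (auto simp: shortest_path_def apath_def)
    then have "Q = P" using Q P apath_eqI_subset by (auto simp: shortest_path_def)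
    then show False using Q by simp
  qed
qed (auto simp: detour_cut_def detour_arcs_def)

text \<open>Take for \<open>Y\<close> the vertices off \<open>P\<close> that are reachable from
  \<open>P\<close> by detour arcs outside \<open>S\<close>. A cut arc missing from \<open>S\<close>
  would have to end on \<open>P\<close> and complete a detour that \<open>S\<close> does not
  hit.\<close>

lemma anti_forcing_set_contains_detour_cut:
  assumes S: "anti_forcing_set w s t P S"
  obtains Y where "Y \<subseteq> verts G" "Y \<inter> set (awalk_verts s P) = {}" "detour_cut Y \<subseteq> S"
proof
  define R where "R = {v. \<exists>x\<in>set (awalk_verts s P). \<exists>q. awalk x q v \<and> set q \<subseteq> detour_arcs - S}"
  show "R - set (awalk_verts s P) \<subseteq> verts G" by (auto simp: R_def)
  show "(R - set (awalk_verts s P)) \<inter> set (awalk_verts s P) = {}" by blast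
  show "detour_cut (R - set (awalk_verts s P)) \<subseteq> S"
  proof (rule subsetI, rule ccontr)
    fix e assume e: "e \<in> detour_cut (R - set (awalk_verts s P))" "e \<notin> S"
    have arc: "e \<in> arcs G" "e \<in> detour_arcs" using e(1) by (auto simp: detour_cut_def detour_arcs_def)
    have "x \<in> R" if "x \<in> set (awalk_verts s P)" for x
    proof -
      have "awalk x [] x" using that awalk_P by (auto simp: awalk_Nil_iff)
      then show ?thesis using that unfolding R_def by force
    qed
    then have "tail G e \<in> R" using e(1) by (auto simp: detour_cut_def)
    then obtain x q where q: "x \<in> set (awalk_verts s P)" "awalk x q (tail G e)" "set q \<subseteq> detour_arcs - S"
      unfolding R_def by blast
    have walk: "awalk x (q @ [e]) (head G e)" using q(2) arc_implies_awalk[OF arc(1)] by (rule awalk_appendI)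
    have sub: "set (q @ [e]) \<subseteq> detour_arcs - S" using q(3) arc(2) e(2) by simp
    have "head G e \<in> R" using q(1) walk sub unfolding R_def by blast
    then have y: "head G e \<in> set (awalk_verts s P)" using e(1) by (auto simp: detour_cut_def)
    obtain p1 p2 where p1: "P = p1 @ p2" "awalk s p1 x" using awalk_decomp[OF awalk_P q(1)] by blast
    obtain p3 p4 where p4: "P = p3 @ p4" "awalk (head G e) p4 t" using awalk_decomp[OF awalk_P y] by blast
    \<comment> \<open>The positions of \<open>x\<close> and \<open>head G e\<close> on
      \<open>P\<close> are not compared: all arcs are tight, and this alone makes the walk a
      shortest path.\<close>
    let ?Q = "p1 @ (q @ [e]) @ p4"
    have "awalk s ?Q t" using p1(2) walk p4(2) by (blast intro: awalk_appendI)
    moreover have P_arcs: "set p1 \<subseteq> set P" by (subst p1(1)) simp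
    moreover have "set p4 \<subseteq> set P" by (subst p4(1)) simp
    ultimately have "shortest_path w s ?Q t"
      using sub tight_P by (intro shortest_path_if_tight) (auto simp: detour_arcs_def)
    moreover have "?Q \<noteq> P"
    proof
      assume "?Q = P"
      then have "e \<in> set P" by (metis in_set_conv_decomp append_assoc append_Cons append_Nil)
      then show False using arc(2) by (simp add: detour_arcs_def)
    qed
    ultimately have "S \<inter> set ?Q \<noteq> {}" using S unfolding anti_forcing_set_def by blast
    moreover have "S \<inter> set P = {}" using S by (simp add: anti_forcing_set_def)
    ultimately show False using sub \<open>set p1 \<subseteq> set P\<close> \<open>set p4 \<subseteq> set P\<close> by auto
  qed
qed

end

section \<open>Transfer to the numbered, contracted graph\<close>

context tight_potential
begin

lemma contracted_cut:
  assumes vn: "inj_on vn (verts G)" "vn ` verts G \<subseteq> {..<n}" and en: "bij_betw en (arcs G) {..<m}"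
    and src: "\<And>e. e \<in> arcs G \<Longrightarrow> src (en e) =
      (if e \<in> detour_arcs \<and> tail G e \<notin> set (awalk_verts s P) then vn (tail G e) else n)"
    and dst: "\<And>e. e \<in> arcs G \<Longrightarrow> dst (en e) =
      (if e \<notin> detour_arcs then n else if head G e \<in> set (awalk_verts s P) then n + 1 else vn (head G e))"
    and X: "n \<in> X" "n + 1 \<notin> X"
  shows "cut m src dst X = en ` detour_cut {v \<in> verts G. v \<notin> set (awalk_verts s P) \<and> vn v \<in> X}"
proof -
  have "en e \<in> cut m src dst X \<longleftrightarrow> e \<in> detour_cut {v \<in> verts G. v \<notin> set (awalk_verts s P) \<and> vn v \<in> X}"
    if e: "e \<in> arcs G" for e
  proof -
    have "en e < m" using en e by (auto simp: bij_betw_def)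
    then show ?thesis using src[OF e] dst[OF e] X e by (auto simp: cut_def detour_cut_def)
  qed
  moreover have "cut m src dst X \<subseteq> en ` arcs G" using en by (auto simp: cut_def bij_betw_def)
  ultimately show ?thesis by (auto simp: detour_cut_def detour_arcs_def)
qed

text \<open>Each separating cut corresponds to an anti-forcing set of equal size, and each
  anti-forcing set contains one of this kind; so the two minima agree.\<close>

lemma minimum_anti_forcing_set_cut:
  assumes fin: "finite (arcs G)"
    and vn: "inj_on vn (verts G)" "vn ` verts G \<subseteq> {..<n}" and en: "bij_betw en (arcs G) {..<m}"
    and src: "\<And>e. e \<in> arcs G \<Longrightarrow> src (en e) =
      (if e \<in> detour_arcs \<and> tail G e \<notin> set (awalk_verts s P) then vn (tail G e) else n)"
    and dst: "\<And>e. e \<in> arcs G \<Longrightarrow> dst (en e) =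
      (if e \<notin> detour_arcs then n else if head G e \<in> set (awalk_verts s P) then n + 1 else vn (head G e))"
    and X: "n \<in> X" "n + 1 \<notin> X"
    and min: "\<And>Z. n \<in> Z \<Longrightarrow> n + 1 \<notin> Z \<Longrightarrow> card (cut m src dst X) \<le> card (cut m src dst Z)"
  shows "minimum_anti_forcing_set w s t P {e \<in> arcs G. en e \<in> cut m src dst X}"
proof -
  let ?V = "set (awalk_verts s P)"
  let ?Y = "\<lambda>X. {v \<in> verts G. v \<notin> ?V \<and> vn v \<in> X}"
  note cut = contracted_cut[OF vn en src dst]
  have card: "card (cut m src dst Z) = card (detour_cut (?Y Z))" if "n \<in> Z" "n + 1 \<notin> Z" for Z
  proof -
    have "inj_on en (detour_cut (?Y Z))"
      using en by (auto simp: bij_betw_def detour_cut_def detour_arcs_def intro: inj_on_subset)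
    then show ?thesis using cut[OF _ _ that] by (simp add: card_image)
  qed
  have "{e \<in> arcs G. en e \<in> cut m src dst X} = detour_cut (?Y X)"
    using cut[OF _ _ X] en by (auto simp: bij_betw_def detour_cut_def detour_arcs_def inj_on_def)
  moreover have "card (detour_cut (?Y X)) \<le> card S" if S: "anti_forcing_set w s t P S" for S
  proof -
    obtain Y where Y: "Y \<subseteq> verts G" "Y \<inter> ?V = {}" "detour_cut Y \<subseteq> S"
      using anti_forcing_set_contains_detour_cut[OF S] .
    \<comment> \<open>Vertex numbers lie below \<open>n\<close>, so adding the source separates it
      from the sink without changing the trace on vertices off \<open>P\<close>.\<close>
    let ?Z = "insert n (vn ` Y)"
    have less: "vn v < n" if "v \<in> verts G" for v using vn(2) that by auto
    have Z: "n \<in> ?Z" "n + 1 \<notin> ?Z" using less Y(1) by force+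
    have "?Y ?Z = Y"
      using Y(1,2) less inj_onD[OF vn(1)] by fastforce
    then have "card (detour_cut (?Y X)) \<le> card (detour_cut Y)"
      using min[OF Z] card[OF X] card[OF Z] by simp
    also have "\<dots> \<le> card S"
      using Y(3) S fin by (intro card_mono) (auto simp: anti_forcing_set_def intro: finite_subset)
    finally show ?thesis .
  qed
  moreover have "anti_forcing_set w s t P (detour_cut (?Y X))"
    by (rule anti_forcing_set_detour_cut) auto
  ultimately show ?thesis by (simp add: minimum_anti_forcing_set_def)
qed

end

section \<open>The composed program\<close>

definition compute_anti_forcing :: com where
  "compute_anti_forcing = Seq mark_path (Seq dijkstra (Seq contract min_cut))"

text \<open>The loop over \<open>P\<close> is charged with \<open>n\<close> rounds, since a path has
  fewer arcs than the graph has vertices.\<close>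

definition anti_forcing_cost :: "nat \<Rightarrow> nat \<Rightarrow> nat" where
  "anti_forcing_cost n m = ((2 + n * (1 + 2)) + ((2 + m * (1 + 2)) + (1 + (1 + (2 + n * (4 + 2)))))) +
     (dijkstra_cost n m + ((2 + m * (9 + 2)) + min_cut_cost n m))"

lemma poly_bounded_anti_forcing_cost: "poly_bounded anti_forcing_cost"
  unfolding anti_forcing_cost_def dijkstra_cost_def min_cut_cost_def max_flow_cost_def search_cost_def Suc_eq_plus1
  by (intro poly_bounded_intros)

lemma (in fin_digraph) runs_compute_anti_forcing:
  fixes w :: "'b \<Rightarrow> real"
  assumes pos: "\<And>e. e \<in> arcs G \<Longrightarrow> 0 < w e" and s: "s \<in> verts G"
    and P: "shortest_path w s P t"
    and vn: "numbering vn (verts G)" and en: "numbering en (arcs G)"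
    and input: "encodes_input G w s t P vn en \<sigma>"
  shows "runs compute_anti_forcing \<sigma> (anti_forcing_cost (card (verts G)) (card (arcs G)))
    (\<lambda>\<tau>. minimum_anti_forcing_set w s t P (output_set G en \<tau>))"
proof -
  define n m l where "n = card (verts G)" and "m = card (arcs G)" and "l = length P"
  define p tv hv where "p = nmem \<sigma> ''path''" and "tv = nmem \<sigma> ''tail''" and "hv = nmem \<sigma> ''head''"
  define wt where "wt = rmem \<sigma> ''weight''"
  have mem: "nmem \<sigma> ''n'' 0 = n" "nmem \<sigma> ''m'' 0 = m" "nmem \<sigma> ''s'' 0 = vn s" "nmem \<sigma> ''len'' 0 = l"
    and p: "\<And>i. i < l \<Longrightarrow> p i = en (P ! i)"
    and arc: "\<And>e. e \<in> arcs G \<Longrightarrow> tv (en e) = vn (tail G e) \<and> hv (en e) = vn (head G e) \<and> wt (en e) = w e"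
    using input by (simp_all add: encodes_input_def n_def m_def l_def p_def tv_def hv_def wt_def)
  have vn: "inj_on vn (verts G)" "vn ` verts G = {..<n}" and en: "bij_betw en (arcs G) {..<m}"
    using vn en by (simp_all add: numbering_def bij_betw_def n_def m_def)
  have less: "vn v < n" if "v \<in> verts G" for v using vn(2) that by auto
  have arcE: "\<exists>e\<in>arcs G. k = en e" if "k < m" for k using en that by (auto simp: bij_betw_def)
  have ap: "apath s P t" and walk: "awalk s P t" using P by (auto simp: shortest_path_def apath_def)
  have Parc: "e \<in> arcs G" if "e \<in> set P" for e using walk that by auto
  have len: "l \<le> n" using length_apath_less[OF ap] by (simp add: l_def n_def)
  have verts_P: "set (awalk_verts s P) = insert s (head G ` set P)"
  proof (cases "P = []")
    case False
    have "cas s P t" using walk by auto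
    then show ?thesis using False awalk_verts_conv'[of s P t] by (cases P) auto
  qed simp
  have on_verts: "vn x = vn s \<or> (\<exists>i<l. hv (p i) = vn x) \<longleftrightarrow> x \<in> set (awalk_verts s P)"
    if x: "x \<in> verts G" for x
  proof -
    have "hv (p i) = vn x \<longleftrightarrow> head G (P ! i) = x" if "i < l" for i
      using p[OF that] arc[OF Parc] that x inj_onD[OF vn(1)] Parc by (auto simp: l_def)
    moreover have "vn x = vn s \<longleftrightarrow> x = s" using inj_onD[OF vn(1)] x s by auto
    ultimately show ?thesis unfolding verts_P by (auto simp: set_conv_nth l_def)
  qed
  have on_arcs: "(\<exists>i<l. p i = en e) \<longleftrightarrow> e \<in> set P" if e: "e \<in> arcs G" for e
  proof -
    have "p i = en e \<longleftrightarrow> P ! i = e" if "i < l" for i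
      using p[OF that] that e Parc inj_onD[OF bij_betw_imp_inj_on[OF en]] by (auto simp: l_def)
    then show ?thesis by (auto simp: in_set_conv_nth l_def)
  qed
  have "awalk_cost w P = (\<Sum>i<l. w (P ! i))"
    by (simp add: awalk_cost_def sum_list_sum_nth l_def atLeast0LessThan)
  also have "\<dots> = (\<Sum>i<l. wt (p i))"
    using p arc Parc by (intro sum.cong) (auto simp: l_def)
  finally have total: "(\<Sum>i<l. wt (p i)) = awalk_cost w P" by simp
  have nonneg: "\<And>e. e \<in> arcs G \<Longrightarrow> 0 \<le> w e" using pos by (simp add: less_imp_le)
  obtain \<pi> where \<pi>: "\<And>e. e \<in> arcs G \<Longrightarrow> \<pi> (head G e) \<le> \<pi> (tail G e) + w e"
    "\<pi> s = 0" "\<pi> t = awalk_cost w P" "\<And>v. \<pi> v \<le> awalk_cost w P"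
    using shortest_path_potential[OF P nonneg] by blast
  \<comment> \<open>The program sees vertex numbers only, so the witness is transported along
    \<open>vn\<close>.\<close>
  define \<pi>' where "\<pi>' = (\<lambda>k. \<pi> (the_inv_into (verts G) vn k))"
  have \<pi>': "\<pi>' (vn v) = \<pi> v" if "v \<in> verts G" for v
    using that by (simp add: \<pi>'_def the_inv_into_f_f[OF vn(1)])
  have arcs: "tv k < n \<and> hv k < n \<and> 0 < wt k \<and> \<pi>' (hv k) \<le> \<pi>' (tv k) + wt k" if "k < m" for k
    using arcE[OF that] arc less pos \<pi>(1) \<pi>' by auto
  note path = runs_mark_path[OF mem p_def[symmetric] hv_def[symmetric] wt_def[symmetric]]
  show ?thesis
    unfolding compute_anti_forcing_def anti_forcing_cost_def n_def[symmetric] m_def[symmetric]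
  proof (rule runs_Seq, rule runs_le[OF path], goal_cases)
    case 1
    show ?case using len by simp
  next
    case (2 \<tau>)
    have a: "agree {''i'', ''on_path'', ''in_path'', ''total'', ''e''} \<sigma> \<tau>" using 2(2) by (simp add: writes_mark_path)
    have fr: "nmem \<tau> ''n'' 0 = n" "nmem \<tau> ''m'' 0 = m" "nmem \<tau> ''s'' 0 = vn s"
      "nmem \<tau> ''tail'' = tv" "nmem \<tau> ''head'' = hv" "rmem \<tau> ''weight'' = wt"
      using mem agree_nmem[OF a] agree_rmem[OF a] by (simp_all add: tv_def hv_def wt_def)
    have on: "0 < nmem \<tau> ''on_path'' (vn x) \<longleftrightarrow> x \<in> set (awalk_verts s P)" if "x \<in> verts G" for x
      using 2(1) less[OF that] on_verts[OF that] by simp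
    have on_arc: "nmem \<tau> ''in_path'' (en e) = 0 \<longleftrightarrow> e \<notin> set P" if "e \<in> arcs G" for e
    proof -
      have "en e < m" using en that by (auto simp: bij_betw_def)
      then show ?thesis using 2(1) on_arcs[OF that] by (metis neq0_conv)
    qed
    have tot: "rmem \<tau> ''total'' 0 = awalk_cost w P" using 2(1) total by simp
    show ?case
    proof (rule runs_Seq, rule runs_dijkstra[OF fr tot, where \<pi> = \<pi>'], goal_cases)
      case (6 \<upsilon>)
      have a: "agree {''i'', ''done'', ''dist'', ''r'', ''u''} \<tau> \<upsilon>" using 6(2) by (simp add: writes_dijkstra)
      have fu: "nmem \<upsilon> ''n'' 0 = n" "nmem \<upsilon> ''m'' 0 = m"
        "nmem \<upsilon> ''tail'' = tv" "nmem \<upsilon> ''head'' = hv" "rmem \<upsilon> ''weight'' = wt"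
        "nmem \<upsilon> ''on_path'' = nmem \<tau> ''on_path''" "nmem \<upsilon> ''in_path'' = nmem \<tau> ''in_path''"
        using fr agree_nmem[OF a] agree_rmem[OF a] by simp_all
      define d where "d = (\<lambda>v. rmem \<upsilon> ''dist'' (vn v))"
      have dist: "rmem \<upsilon> ''dist'' (vn v) = d v" for v by (simp add: d_def)
      have feasible: "d (head G e) \<le> d (tail G e) + w e" if "e \<in> arcs G" for e
      proof -
        have "en e < m" using en that by (auto simp: bij_betw_def)
        then show ?thesis using 6(1) arc[OF that] by (auto simp: d_def)
      qed
      have lower: "\<pi> v \<le> d v" if "v \<in> verts G" for v using 6(1) less[OF that] \<pi>'[OF that] by (auto simp: d_def)
      \<comment> \<open>The potential \<open>\<pi>\<close> bounds \<open>d\<close> from below at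
        both ends; the upper bounds come from the label of \<open>s\<close> and from feasibility
        along \<open>P\<close>.\<close>
      have "d s = 0" using 6(1) lower[OF s] \<pi>(2) by (simp add: d_def)
      moreover have "d t \<le> d s + awalk_cost w P" using potential_le_cost[OF feasible walk] .
      moreover have "awalk_cost w P \<le> d t" using lower[of t] walk \<pi>(3) by auto
      ultimately have ends: "d t = d s + awalk_cost w P" by simp
      interpret tight_potential G w s t P d
        using pos P feasible ends by unfold_locales
      show ?case
      proof (rule runs_Seq[OF runs_contract[OF fu refl]], goal_cases)
        case (1 \<phi>)
        define src dst where "src = nmem \<phi> ''src''" and "dst = nmem \<phi> ''dst''"
        have fphi: "nmem \<phi> ''n'' 0 = n" "nmem \<phi> ''m'' 0 = m"
          using agree_nmem[OF 1(2)] fu by (simp_all add: contract_def Let_def)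
        have src_dst: "src (en e) = (if e \<in> detour_arcs \<and> tail G e \<notin> set (awalk_verts s P) then vn (tail G e) else n)"
          "dst (en e) = (if e \<notin> detour_arcs then n else if head G e \<in> set (awalk_verts s P) then n + 1 else vn (head G e))"
          if e: "e \<in> arcs G" for e
        proof -
          have lt: "en e < m" using en e by (auto simp: bij_betw_def)
          have "e \<in> detour_arcs \<longleftrightarrow> nmem \<tau> ''in_path'' (en e) = 0 \<and>
              rmem \<upsilon> ''dist'' (tv (en e)) + wt (en e) \<le> rmem \<upsilon> ''dist'' (hv (en e))"
            using feasible[OF e] e on_arc[OF e] arc[OF e] by (auto simp: detour_arcs_def dist)
          then show "src (en e) = (if e \<in> detour_arcs \<and> tail G e \<notin> set (awalk_verts s P) then vn (tail G e) else n)"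
            "dst (en e) = (if e \<notin> detour_arcs then n else if head G e \<in> set (awalk_verts s P) then n + 1 else vn (head G e))"
            using 1(1)[rule_format, OF lt] arc[OF e] on[of "tail G e"] on[of "head G e"] e
            unfolding src_def dst_def by (simp_all split: if_splits)
        qed
        have bounds: "src k < n + 2 \<and> dst k < n + 2" if "k < m" for k
        proof -
          obtain e where e: "e \<in> arcs G" "k = en e" using arcE[OF \<open>k < m\<close>] by blast
          then have "vn (tail G e) < n" "vn (head G e) < n" using less by auto
          then show ?thesis using src_dst[OF e(1)] e(2) by simp
        qed
        show ?case
        proof (rule runs_mono[OF runs_min_cut[OF fphi src_def[symmetric] dst_def[symmetric] bounds]], goal_cases)
          case (3 \<psi>)
          then obtain X where X: "n \<in> X" "n + 1 \<notin> X"
            and out: "\<forall>e<m. nmem \<psi> ''out'' e \<noteq> 0 \<longleftrightarrow> e \<in> cut m src dst X"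
            and min: "\<And>Z. n \<in> Z \<Longrightarrow> n + 1 \<notin> Z \<Longrightarrow> card (cut m src dst X) \<le> card (cut m src dst Z)"
            by blast
          have "output_set G en \<psi> = {e \<in> arcs G. en e \<in> cut m src dst X}"
            using out en by (auto simp: output_set_def bij_betw_def)
          then show ?case
            using minimum_anti_forcing_set_cut[OF finite_arcs vn(1) _ en src_dst X min] vn(2) by simp
        qed auto
      qed
    qed (use less[OF s] \<pi> \<pi>' s arcs vn(2) pos_cost_pos_awalk_cost[OF walk nonneg] in \<open>auto simp: \<pi>'_def\<close>)
  qed
qed

theorem theorem3:
  shows "\<exists>(c :: com) (p :: nat poly).
    \<forall>(G :: ('v, 'e) pre_digraph) (w :: 'e \<Rightarrow> real) (s :: 'v) (t :: 'v) (P :: 'e list)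
      (vn :: 'v \<Rightarrow> nat) (en :: 'e \<Rightarrow> nat) (\<sigma> :: state).
      fin_digraph G \<longrightarrow>
      (\<forall>e\<in>arcs G. 0 < w e) \<longrightarrow>
      s \<in> verts G \<longrightarrow> t \<in> verts G \<longrightarrow>
      wf_digraph.shortest_path G w s P t \<longrightarrow>
      numbering vn (verts G) \<longrightarrow> numbering en (arcs G) \<longrightarrow>
      encodes_input G w s t P vn en \<sigma> \<longrightarrow>
      (\<exists>k \<sigma>'. exec c \<sigma> k \<sigma>' \<and>
        k \<le> poly p (card (verts G) + card (arcs G)) \<and>
        wf_digraph.minimum_anti_forcing_set G w s t P (output_set G en \<sigma>'))"
proof -
  obtain p :: "nat poly" where p: "\<And>n m. anti_forcing_cost n m \<le> poly p (n + m)"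
    using poly_bounded_anti_forcing_cost by (auto simp: poly_bounded_def)
  show ?thesis
  proof (intro exI[of _ compute_anti_forcing] exI[of _ p] allI impI, goal_cases)
    case (1 G w s t P vn en \<sigma>)
    then interpret fin_digraph G by simp
    from runs_compute_anti_forcing[of w s P t vn en \<sigma>] 1
    obtain k \<sigma>' where "exec compute_anti_forcing \<sigma> k \<sigma>'"
      "k \<le> anti_forcing_cost (card (verts G)) (card (arcs G))"
      "minimum_anti_forcing_set w s t P (output_set G en \<sigma>')"
      by (auto simp: runs_def)
    then show ?case using p le_trans by blast
  qed
qed

end
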